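(* Let $n_1\in\mathbb{N}$. Let $X_1,X_2,\ldots$ be mean zero random variables with finite variances. Suppose that $X_1,\ldots,X_{n_1}$ and $X_{n_1+1},X_{n_1+2},\ldots$ form two independent groups of i.i.d. random variables, where the distributions may differ between the two groups. Let $W=\sum_{i=1}^NX_i$, where $N$ is a binomial random variable with parameters $n$ and $p$, independent of $\{X_i\}_{i=1}^\infty$, and let $$\sigma^2:=\mathrm{Var}(W)=\sum_{i=1}^{n_1}\mathrm{Var}(X_1)P(N\ge i)+\sum_{i=n_1+1}^{n}\mathrm{Var}(X_{n_1+1})P(N\ge i).$$ Then $$\begin{aligned}d_1\big(\mathcal{L}(W/\sigma),\mathcal{L}(Z)\big)&\le\frac1{\sigma^3}\sum_{i=1}^{n_1}\left(\mathbb{E}|X_1|^3+2\,\mathbb{E}X_1^2\,\mathbb{E}|X_1|\right)P(N\ge i)^2\\&\quad+\frac1{\sigma^3}\sum_{i=n_1+1}^{n}\left(\mathbb{E}|X_{n_1+1}|^3+2\,\mathbb{E}X_{n_1+1}^2\,\mathbb{E}|X_{n_1+1}|\right)P(N\ge i)^2\\&\quad+\frac{2\sqrt2}{\sqrt\pi}\left(1-\sum_{i=1}^{n_1}\frac{\mathrm{Var}(X_1)}{\sigma^2}P(N\ge i)^2-\sum_{i=n_1+1}^{n}\frac{\mathrm{Var}(X_{n_1+1})}{\sigma^2}P(N\ge i)^2\right),\end{aligned}$$ where $Z$ is a standard normal random variable.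
   Context: $\mathcal{L}(X)$ denotes the distribution of $X$. The $L^1$ (Wasserstein) distance is $d_1(\mathcal{L}(X),\mathcal{L}(Y))=\int_{-\infty}^\infty|P(X\le t)-P(Y\le t)|\,dt=\sup_{h}|\mathbb{E}h(X)-\mathbb{E}h(Y)|$, the supremum being over all $h:\mathbb{R}\to\mathbb{R}$ with $|h(y)-h(x)|\le|y-x|$ for all $x,y$. Sums $\sum_{i=n_1+1}^{n}$ are empty (equal to $0$) when $n_1\ge n$. It is presupposed that $\sigma^2>0$, so that the normalization makes sense. *)

theory Defs
  imports "HOL-Probability.Probability"
begin

(* Independence of two random elements. The library's indep_var requires both to take values
   in the same type; this is the characterisation indep_var_eq with distinct value types. *)
definition indep_elements ::
  "'a measure \<Rightarrow> 'b measure \<Rightarrow> ('a \<Rightarrow> 'b) \<Rightarrow> 'c measure \<Rightarrow> ('a \<Rightarrow> 'c) \<Rightarrow> bool" where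
  "indep_elements M S X T Y \<longleftrightarrow>
     X \<in> measurable M S \<and> Y \<in> measurable M T \<and>
     prob_space.indep_set M
       (sigma_sets (space M) {X -` A \<inter> space M | A. A \<in> sets S})
       (sigma_sets (space M) {Y -` A \<inter> space M | A. A \<in> sets T})"

definition iid_on :: "'a measure \<Rightarrow> 'i set \<Rightarrow> ('i \<Rightarrow> 'a \<Rightarrow> real) \<Rightarrow> bool" where
  "iid_on M I X \<longleftrightarrow>
     prob_space.indep_vars M (\<lambda>_. borel) X I \<and>
     (\<forall>i\<in>I. \<forall>j\<in>I. distr M borel (X i) = distr M borel (X j))"

(* The family (X i), i in I, as one random element of the product space. *)
definition family :: "'i set \<Rightarrow> ('i \<Rightarrow> 'a \<Rightarrow> real) \<Rightarrow> 'a \<Rightarrow> 'i \<Rightarrow> real" where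
  "family I X \<omega> = (\<lambda>i\<in>I. X i \<omega>)"

(* L1 (Wasserstein) distance between laws on the real line; possibly infinite. *)
definition d1 :: "real measure \<Rightarrow> real measure \<Rightarrow> ennreal" where
  "d1 \<mu> \<nu> = (\<integral>\<^sup>+ t. ennreal \<bar>cdf \<mu> t - cdf \<nu> t\<bar> \<partial>lborel)"

(* E|Y|^3 + 2 E[Y^2] E|Y|.  The third absolute moment may be infinite, hence the value in
   ennreal (a Bochner integral would silently be 0 there). *)
definition moment_term :: "'a measure \<Rightarrow> ('a \<Rightarrow> real) \<Rightarrow> ennreal" where
  "moment_term M Y =
     (\<integral>\<^sup>+ \<omega>. ennreal (\<bar>Y \<omega>\<bar> ^ 3) \<partial>M) +
     2 * (\<integral>\<^sup>+ \<omega>. ennreal ((Y \<omega>)\<^sup>2) \<partial>M) * (\<integral>\<^sup>+ \<omega>. ennreal \<bar>Y \<omega>\<bar> \<partial>M)"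

end

theory Submission
  imports Defs "HOL-Real_Asymp.Real_Asymp"
begin

text \<open>
  Stein's method. Write \<open>W = (\<Sum>i=1..n. J i * Y i)\<close> with \<open>J i\<close> the indicator of \<open>i \<le> N\<close> and
  \<open>Y i\<close> normalized, and let \<open>V i\<close> be \<open>W\<close> without its \<open>i\<close>-th summand, so that \<open>Y i\<close> is independent
  of \<open>(J i, V i)\<close>. Taylor expansion of the Stein solution \<open>f\<close> at \<open>V i\<close> turns \<open>E (J i * Y i * f W)\<close>
  into \<open>E ((Y i)\<^sup>2) * E (J i * f' W)\<close>, with an error governed by \<open>\<bar>f''\<bar> \<le> 2\<close>.
  Replacing the restricted expectation of \<open>f' W\<close> by \<open>P (i \<le> N)\<close> times the full one costs
  \<open>2 * sup \<bar>f'\<bar> * P (i \<le> N) * P (i > N)\<close>, and \<open>\<bar>f'\<bar> \<le> sqrt (2 / pi)\<close>. Finally the \<open>L\<^sup>1\<close> distance of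
  the distribution functions is the supremum of \<open>\<integral> g * (F - \<Phi>)\<close> over continuous \<open>\<bar>g\<bar> \<le> 1\<close>, and each such
  integral is a difference of expectations of a 1-Lipschitz antiderivative of \<open>- g\<close>.
\<close>

section \<open>The standard normal distribution function\<close>

text \<open>All summands share the counter \<open>N\<close>, so \<open>J i\<close> is correlated
  with \<open>V i\<close> and with \<open>W\<close>, and the expectation of
  \<open>J i * f' W\<close> does not factor. The Taylor estimate by itself leaves only one factor
  \<open>P (i \<le> N)\<close> on the moment terms. The square arises from using that estimate with
  weight \<open>P (i \<le> N)\<close> and a crude variance bound with weight
  \<open>P (i > N)\<close>. The crude part carries the bound on \<open>f'\<close>, so the sharp
  constant there matters, whereas the bound 1 on \<open>f\<close> secures integrability. The
  constant comes from a Gaussian inequality: the expectations of \<open>max 0 (x - Z)\<close> and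
  \<open>max 0 (Z - x)\<close> have product at most the density at 0 times the density at
  \<open>x\<close>, with equality at \<open>x = 0\<close>; twice the density at 0 is
  \<open>sqrt (2 / pi)\<close>. Third moments may be infinite. The estimate is therefore proved with
  real integrals under an integrability assumption and moved to \<open>ennreal\<close> at the end,
  where the remaining case has an infinite right-hand side.\<close>

lemma set_integral_atMost_diff:
  fixes f :: "real \<Rightarrow> real"
  assumes f: "integrable lborel f" and "x \<le> y"
  shows "(LINT t:{..y}|lborel. f t) - (LINT t:{..x}|lborel. f t) = integral {x..y} f"
proof -
  have i: "set_integrable lborel S f" if "S \<in> sets borel" for S
    unfolding set_integrable_def by (rule integrable_mult_indicator) (use f that in auto)
  have "{..y} = {..x} \<union> {x<..y}" using \<open>x \<le> y\<close> by auto
  hence "(LINT t:{..y}|lborel. f t) = (LINT t:{..x}|lborel. f t) + (LINT t:{x<..y}|lborel. f t)"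
    by (simp add: i, subst set_integral_Un) (auto simp: i)
  also have "(LINT t:{x<..y}|lborel. f t) = (LINT t:{x..y}|lborel. f t)"
    unfolding set_lebesgue_integral_def
    by (rule integral_cong_AE)
       (use f in \<open>auto intro!: eventually_mono[OF AE_lborel_singleton[of x]] split: split_indicator\<close>)
  also have "\<dots> = integral {x..y} f" by (rule set_borel_integral_eq_integral(2)[OF i]) simp
  finally show ?thesis by simp
qed

lemma integrable_on_interval_of_lborel:
  fixes f :: "real \<Rightarrow> real"
  assumes "integrable lborel f" shows "f integrable_on {a..b}"
  by (rule set_borel_integral_eq_integral(1))
    (unfold set_integrable_def, rule integrable_mult_indicator, use assms in auto)

text \<open>Anchoring at \<open>x - 1\<close> makes \<open>x\<close> an interior point of a compact
  interval, where the fundamental theorem of calculus applies; the half-line integral up to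
  \<open>x - 1\<close> is an additive constant.\<close>

lemma has_real_derivative_integral_atMost:
  fixes f :: "real \<Rightarrow> real"
  assumes f: "integrable lborel f" and c: "continuous_on UNIV f"
  shows "((\<lambda>x. LINT t:{..x}|lborel. f t) has_real_derivative f x) (at x)"
proof -
  let ?K = "\<lambda>x. LINT t:{..x}|lborel. f t"
  have "((\<lambda>u. integral {x-1..u} f) has_real_derivative f x) (at x within {x-1..x+1})"
    by (rule integral_has_real_derivative) (use c in \<open>auto intro: continuous_on_subset\<close>)
  hence "((\<lambda>u. integral {x-1..u} f) has_real_derivative f x) (at x)"
    by (simp add: at_within_Icc_at)
  hence "((\<lambda>u. ?K (x - 1) + integral {x-1..u} f) has_real_derivative f x) (at x)"
    by (auto intro!: derivative_eq_intros)
  thus ?thesis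
    by (rule has_field_derivative_transform_within_open[where S="{x-1<..}"])
       (auto simp: set_integral_atMost_diff[OF f, symmetric])
qed

abbreviation Phi :: "real \<Rightarrow> real" where "Phi \<equiv> cdf std_normal_distribution"

lemma Phi_eq: "Phi x = (LINT t:{..x}|lborel. std_normal_density t)"
proof -
  have "emeasure std_normal_distribution {..x} = \<integral>\<^sup>+t. ennreal (indicator {..x} t *\<^sub>R std_normal_density t) \<partial>lborel"
    by (subst emeasure_density) (auto intro!: nn_integral_cong split: split_indicator)
  also have "\<dots> = ennreal (LINT t:{..x}|lborel. std_normal_density t)"
    unfolding set_lebesgue_integral_def
    by (rule nn_integral_eq_integral, rule integrable_mult_indicator) auto
  finally show ?thesis
    unfolding cdf_def measure_def
    by (simp add: set_lebesgue_integral_def)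
qed

lemma continuous_std_normal_density: "continuous_on S std_normal_density"
  unfolding std_normal_density_def[abs_def] by (intro continuous_intros) auto

lemma std_normal_density_deriv [derivative_intros]:
  "(std_normal_density has_real_derivative - x * std_normal_density x) (at x)"
  unfolding std_normal_density_def[abs_def]
  by (auto intro!: derivative_eq_intros simp: field_simps power2_eq_square)

lemma Phi_deriv [derivative_intros]: "(Phi has_real_derivative std_normal_density x) (at x)"
  unfolding Phi_eq[abs_def]
  by (rule has_real_derivative_integral_atMost) (auto simp: continuous_std_normal_density)

lemma std_normal_real_distribution: "real_distribution std_normal_distribution"
  by (simp add: real_distribution_def real_distribution_axioms_def prob_space_normal_density)

interpretation std_normal: real_distribution std_normal_distribution
  by (rule std_normal_real_distribution)

lemma std_normal_density_minus: "std_normal_density (- x) = std_normal_density x"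
  by (simp add: std_normal_density_def)

text \<open>Identities between half-line integrals are obtained this way: differentiation removes
  the integrals, and the constant is read off at infinity.\<close>

lemma const_of_deriv_zero_limit:
  fixes f :: "real \<Rightarrow> real"
  assumes "\<And>x. (f has_real_derivative 0) (at x)" and "(f \<longlongrightarrow> L) at_top"
  shows "f x = L"
proof -
  have "f y = f x" for y
    by (metis DERIV_isconst_all assms(1))
  hence "f = (\<lambda>_. f x)" by auto
  with assms(2) have "((\<lambda>_::real. f x) \<longlongrightarrow> L) at_top" by metis
  thus ?thesis by (simp add: tendsto_const_iff)
qed

lemma Phi_minus: "Phi (- x) = 1 - Phi x"
proof -
  have "Phi x + Phi (- x) = 1 + 0"
  proof (rule const_of_deriv_zero_limit[where f="\<lambda>x. Phi x + Phi (- x)"])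
    show "((\<lambda>x. Phi x + Phi (- x)) has_real_derivative 0) (at x)" for x
      by (auto intro!: derivative_eq_intros DERIV_chain2[OF Phi_deriv] simp: std_normal_density_minus)
    show "((\<lambda>x. Phi x + Phi (- x)) \<longlongrightarrow> 1 + 0) at_top"
      by (intro tendsto_add std_normal.cdf_lim_at_top_prob
            filterlim_compose[OF std_normal.cdf_lim_at_bot filterlim_uminus_at_bot_at_top])
  qed
  thus ?thesis by simp
qed

lemma Phi_0: "Phi 0 = 1 / 2"
  using Phi_minus[of 0] unfolding minus_zero by linarith

section \<open>Gaussian tail inequalities\<close>

lemma std_normal_density_at_top: "(std_normal_density \<longlongrightarrow> 0) at_top"
  unfolding std_normal_density_def[abs_def] by real_asymp

text \<open>For tail inequalities the known boundary value lies at infinity. Derivatives are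
  required only to the right of \<open>x\<close>, because one application divides by
  \<open>2 * x + x^3\<close>, which is singular at 0.\<close>

lemma nonneg_of_nonpos_deriv_limit:
  fixes f f' :: "real \<Rightarrow> real"
  assumes "\<And>y. y \<ge> x \<Longrightarrow> (f has_real_derivative f' y) (at y)" "\<And>y. y \<ge> x \<Longrightarrow> f' y \<le> 0"
    and "(f \<longlongrightarrow> 0) at_top"
  shows "f x \<ge> 0"
proof (rule tendsto_upperbound[OF assms(3)])
  show "\<forall>\<^sub>F y in at_top. f y \<le> f x"
    using eventually_ge_at_top[of x]
  proof eventually_elim
    case (elim y)
    show "f y \<le> f x"
      by (rule DERIV_nonpos_imp_nonincreasing[OF elim]) (meson assms(1,2))
  qed
qed simp

lemma Phi_compl_at_top: "((\<lambda>x. 1 - Phi x) \<longlongrightarrow> 0) at_top"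
  by (rule tendsto_eq_intros std_normal.cdf_lim_at_top_prob refl | simp)+

text \<open>The classical lower bound for the Mills ratio, here for every real \<open>x\<close>.
  Applied at \<open>x\<close> and \<open>- x\<close> it makes both coefficients nonnegative in the
  bound on the second derivative of the Stein solution.\<close>

lemma Mills_lower: "x * std_normal_density x \<le> (1 + x\<^sup>2) * (1 - Phi x)"
proof -
  have "0 \<le> 1 - Phi x - x * std_normal_density x / (1 + x\<^sup>2)"
  proof (rule nonneg_of_nonpos_deriv_limit[where f = "\<lambda>x. 1 - Phi x - x * std_normal_density x / (1 + x\<^sup>2)"
        and f' = "\<lambda>x. - 2 * std_normal_density x / (1 + x\<^sup>2)^2"])
    fix y :: real
    have nz: "1 + y\<^sup>2 \<noteq> 0" by (metis add_pos_nonneg less_numeral_extra(1,3) zero_le_power2)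
    show "((\<lambda>x. 1 - Phi x - x * std_normal_density x / (1 + x\<^sup>2)) has_real_derivative
        - 2 * std_normal_density y / (1 + y\<^sup>2)^2) (at y)"
      using nz
      apply (auto intro!: derivative_eq_intros)
      apply (simp add: divide_simps power2_eq_square)
      apply algebra
      done
  next
    have "((\<lambda>x::real. x * std_normal_density x / (1 + x\<^sup>2)) \<longlongrightarrow> 0) at_top"
      unfolding std_normal_density_def by real_asymp
    thus "((\<lambda>x. 1 - Phi x - x * std_normal_density x / (1 + x\<^sup>2)) \<longlongrightarrow> 0) at_top"
      using tendsto_diff[OF Phi_compl_at_top] by fastforce
  qed simp
  moreover have "1 + x\<^sup>2 > 0" by (simp add: add_pos_nonneg)
  ultimately show ?thesis by (simp add: field_simps)
qed

text \<open>The value at \<^term>\<open>x\<close> is the expectation of \<open>max 0 (x - Z)\<close> for a standard normal \<open>Z\<close>.\<close>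

definition normal_excess :: "real \<Rightarrow> real" where "normal_excess x = std_normal_density x + x * Phi x"

lemma normal_excess_minus: "normal_excess (- x) = std_normal_density x - x * (1 - Phi x)"
  by (simp add: normal_excess_def Phi_minus std_normal_density_minus)

lemma normal_excess_deriv [derivative_intros]: "(normal_excess has_real_derivative Phi x) (at x)"
  unfolding normal_excess_def[abs_def] by (auto intro!: derivative_eq_intros)

text \<open>The density has derivative \<open>- t * std_normal_density t\<close>, so the two sides
  differ by a constant; it is zero because the full first moment vanishes. This evaluates the
  majorants of \<open>P\<close> and \<open>Q\<close> in \<open>stein_solution\<close>.\<close>

lemma std_normal_first_moment_atMost:
  "(LINT t:{..x}|lborel. std_normal_density t * t) = - std_normal_density x"
proof -
  have i: "integrable lborel (\<lambda>t. std_normal_density t * t)"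
    using integrable_std_normal_moment[of 1] by simp
  have "(LINT t:{..x}|lborel. std_normal_density t * t) + std_normal_density x = 0 + 0"
  proof (rule const_of_deriv_zero_limit[where f="\<lambda>x. (LINT t:{..x}|lborel. std_normal_density t * t) + std_normal_density x"])
    show "((\<lambda>x. (LINT t:{..x}|lborel. std_normal_density t * t) + std_normal_density x) has_real_derivative 0) (at x)" for x
    proof -
      have "continuous_on UNIV (\<lambda>t. std_normal_density t * t)"
        by (intro continuous_on_mult continuous_std_normal_density continuous_on_id)
      from DERIV_add[OF has_real_derivative_integral_atMost[OF i this] std_normal_density_deriv]
      show ?thesis by simp
    qed
    have "(LINT t|lborel. std_normal_density t * t) = 0"
      using integral_std_normal_moment_odd[of 0] by simp
    hence "((\<lambda>x. LINT t:{..x}|lborel. std_normal_density t * t) \<longlongrightarrow> 0) at_top"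
      using tendsto_integral_at_top[of lborel "\<lambda>t. std_normal_density t * t"] i
      by (simp add: set_lebesgue_integral_def)
    thus "((\<lambda>x. (LINT t:{..x}|lborel. std_normal_density t * t) + std_normal_density x) \<longlongrightarrow> 0 + 0) at_top"
      by (intro tendsto_add std_normal_density_at_top)
  qed
  thus ?thesis by simp
qed

text \<open>Up to a positive factor, the difference of the two sides is minus the derivative of
  \<open>normal_excess x * normal_excess (- x) / std_normal_density x\<close>. Divided by \<open>2 * x + x^3\<close> it has
  derivative \<open>std_normal_density x / (x * (2 + x\<^sup>2))\<^sup>2 * R x\<close> with \<open>R \<le> 0\<close>, and it vanishes at infinity.\<close>

lemma Phi_compl_product_lower:
  fixes x :: real assumes "x > 0"
  defines "\<phi> \<equiv> std_normal_density x" and "s \<equiv> 2 * Phi x - 1"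
  shows "\<phi> * (x * \<phi> + (1 + x\<^sup>2) * s) \<le> (2 * x + x^3) * (Phi x * (1 - Phi x))"
proof -
  define R where "R = (\<lambda>x. (2 - x\<^sup>2) * (2 * Phi x - 1) - 4 * x * std_normal_density x)"
  \<comment> \<open>This fixes the sign of the derivative of \<open>R\<close>, which is
    \<open>2 * z * (z * std_normal_density z - (2 * Phi z - 1))\<close>; with \<open>R 0 = 0\<close>
    it yields \<open>R \<le> 0\<close>.\<close>
  have s_ge: "y * std_normal_density y \<le> 2 * Phi y - 1" if "y \<ge> 0" for y
  proof -
    have "2 * Phi 0 - 1 - 0 * std_normal_density 0 \<le> 2 * Phi y - 1 - y * std_normal_density y"
    proof (rule DERIV_nonneg_imp_nondecreasing[OF that])
      fix z :: real assume "0 \<le> z" "z \<le> y"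
      show "\<exists>D. ((\<lambda>y. 2 * Phi y - 1 - y * std_normal_density y) has_real_derivative D) (at z) \<and> 0 \<le> D"
        by (rule exI[of _ "std_normal_density z + z\<^sup>2 * std_normal_density z"])
           (intro conjI, auto intro!: derivative_eq_intros add_nonneg_nonneg simp: power2_eq_square)
    qed
    thus ?thesis using Phi_0 by simp
  qed
  have R_le: "R y \<le> 0" if "y \<ge> 0" for y
  proof -
    have "R y \<le> R 0"
    proof (rule DERIV_nonpos_imp_nonincreasing[OF that])
      fix z :: real assume z: "0 \<le> z" "z \<le> y"
      show "\<exists>D. (R has_real_derivative D) (at z) \<and> D \<le> 0"
        unfolding R_def
      proof (intro exI conjI)
        show "((\<lambda>x. (2 - x\<^sup>2) * (2 * Phi x - 1) - 4 * x * std_normal_density x) has_real_derivative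
            2 * z * (z * std_normal_density z - (2 * Phi z - 1))) (at z)"
          by (auto intro!: derivative_eq_intros simp: power2_eq_square algebra_simps)
        show "2 * z * (z * std_normal_density z - (2 * Phi z - 1)) \<le> 0"
          using z s_ge[of z] by (intro mult_nonneg_nonpos) auto
      qed
    qed
    also have "R 0 = 0" by (simp add: R_def Phi_0)
    finally show ?thesis .
  qed
  let ?f = "\<lambda>x. Phi x * (1 - Phi x)
     - std_normal_density x * (x * std_normal_density x + (1 + x\<^sup>2) * (2 * Phi x - 1)) / (2 * x + x^3)"
  have "0 \<le> ?f x"
  proof (rule nonneg_of_nonpos_deriv_limit[where f = ?f
        and f' = "\<lambda>x. std_normal_density x / (x * (2 + x\<^sup>2))\<^sup>2 * R x"])
    fix y :: real assume "y \<ge> x"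
    hence y: "y > 0" using assms by simp
    have nz: "2 * y + y^3 \<noteq> 0" "2 + y\<^sup>2 \<noteq> 0" using y by (auto simp: add_pos_pos less_imp_neq[symmetric])
    let ?p = "std_normal_density y" and ?s = "2 * Phi y - 1"
    have "(?f has_real_derivative ?p * (1 - Phi y) - Phi y * ?p
        - ((- y * ?p * (y * ?p + (1 + y\<^sup>2) * ?s) + ?p * (?p - y\<^sup>2 * ?p + 2 * y * ?s + (1 + y\<^sup>2) * (2 * ?p)))
             * (2 * y + y^3) - ?p * (y * ?p + (1 + y\<^sup>2) * ?s) * (2 + 3 * y\<^sup>2)) / ((2 * y + y^3) * (2 * y + y^3))) (at y)"
      by (rule derivative_eq_intros refl nz)+ (simp add: power2_eq_square algebra_simps)
    also have "?p * (1 - Phi y) - Phi y * ?p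
        - ((- y * ?p * (y * ?p + (1 + y\<^sup>2) * ?s) + ?p * (?p - y\<^sup>2 * ?p + 2 * y * ?s + (1 + y\<^sup>2) * (2 * ?p)))
             * (2 * y + y^3) - ?p * (y * ?p + (1 + y\<^sup>2) * ?s) * (2 + 3 * y\<^sup>2)) / ((2 * y + y^3) * (2 * y + y^3))
       = ?p / (y * (2 + y\<^sup>2))\<^sup>2 * R y"
    proof -
      define p P where "p = ?p" and "P = Phi y"
      have e: "2 * y + y^3 = y * (2 + y\<^sup>2)" by (simp add: power2_eq_square power3_eq_cube algebra_simps)
      show ?thesis
        unfolding R_def e p_def[symmetric] P_def[symmetric] using nz y
        apply (simp add: divide_simps)
        apply algebra
        done
    qed
    finally show "(?f has_real_derivative ?p / (y * (2 + y\<^sup>2))\<^sup>2 * R y) (at y)" .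
    show "std_normal_density y / (y * (2 + y\<^sup>2))\<^sup>2 * R y \<le> 0"
      using R_le[of y] y by (intro mult_nonneg_nonpos) auto
  next
    \<comment> \<open>The numerator is split so that the explicit Gaussian quotients are expanded
      asymptotically, while \<open>Phi\<close> enters only through its limit 1.\<close>
    have 1: "((\<lambda>x::real. std_normal_density x * (x * std_normal_density x) / (2 * x + x^3)) \<longlongrightarrow> 0) at_top"
      unfolding std_normal_density_def by real_asymp
    have 2: "((\<lambda>x::real. std_normal_density x * (1 + x\<^sup>2) / (2 * x + x^3)) \<longlongrightarrow> 0) at_top"
      unfolding std_normal_density_def by real_asymp
    have "((\<lambda>x. Phi x * (1 - Phi x) - (std_normal_density x * (x * std_normal_density x) / (2 * x + x^3)
        + std_normal_density x * (1 + x\<^sup>2) / (2 * x + x^3) * (2 * Phi x - 1))) \<longlongrightarrow> 1 * 0 - (0 + 0 * (2 * 1 - 1))) at_top"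
      by (intro tendsto_intros 1 2 std_normal.cdf_lim_at_top_prob Phi_compl_at_top)
    moreover have "std_normal_density x * (x * std_normal_density x + (1 + x\<^sup>2) * (2 * Phi x - 1)) / (2 * x + x^3)
        = std_normal_density x * (x * std_normal_density x) / (2 * x + x^3)
          + std_normal_density x * (1 + x\<^sup>2) / (2 * x + x^3) * (2 * Phi x - 1)" for x
      by (simp add: add_divide_distrib[symmetric] algebra_simps)
    ultimately show "(?f \<longlongrightarrow> 0) at_top"
      by simp
  qed
  moreover have "2 * x + x^3 > 0" using assms(1) by (simp add: add_pos_pos)
  ultimately show ?thesis unfolding assms(2,3) by (simp add: pos_divide_le_eq mult.commute)
qed


text \<open>The left-hand side divided by the density at \<open>x\<close> is nonincreasing on the
  half-line from 0, by \<open>Phi_compl_product_lower\<close>; its value at 0 is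
  \<open>std_normal_density 0\<close>.\<close>

lemma normal_excess_mult_bound_pos:
  assumes "x \<ge> 0"
  shows "normal_excess x * normal_excess (- x) \<le> std_normal_density 0 * std_normal_density x"
proof -
  let ?D = "\<lambda>x. normal_excess x * normal_excess (- x) / std_normal_density x"
  have pos: "std_normal_density y > 0" for y by (simp add: normal_density_pos)
  have "?D x \<le> ?D 0"
  proof (rule DERIV_nonpos_imp_nonincreasing[OF assms])
    fix y :: real assume y: "0 \<le> y" "y \<le> x"
    define p P where "p = std_normal_density y" and "P = Phi y"
    let ?d = "((P * normal_excess (- y) + normal_excess y * - (1 - P)) * p - normal_excess y * normal_excess (- y) * (- y * p)) / (p * p)"
    have "((\<lambda>y. normal_excess (- y)) has_real_derivative - (1 - P)) (at y)"
      unfolding P_def Phi_minus[symmetric]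
      by (rule DERIV_cong[OF DERIV_chain2[OF normal_excess_deriv DERIV_minus[OF DERIV_ident]]]) simp
    hence "(?D has_real_derivative ?d) (at y)"
      unfolding p_def P_def
      using pos[of y] by (auto intro!: derivative_eq_intros)
    moreover have "?d \<le> 0"
    proof -
      have "p > 0" using pos p_def by simp
      have "(P * normal_excess (- y) + normal_excess y * - (1 - P)) * p - normal_excess y * normal_excess (- y) * (- y * p)
         = p * (p * (y * p + (1 + y\<^sup>2) * (2 * P - 1)) - (2 * y + y^3) * (P * (1 - P)))"
        unfolding normal_excess_minus unfolding normal_excess_def p_def[symmetric] P_def[symmetric] by algebra
      \<comment> \<open>\<open>Phi_compl_product_lower\<close> needs \<open>y > 0\<close>; at
        \<open>y = 0\<close> the bracket vanishes because \<open>Phi 0 = 1 / 2\<close>.\<close>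
      also have "\<dots> \<le> 0"
        using \<open>p > 0\<close> Phi_compl_product_lower[of y] Phi_0 y
        by (cases "y = 0") (auto intro!: mult_nonneg_nonpos simp: p_def P_def)
      finally show ?thesis using \<open>p > 0\<close> by (simp add: divide_nonpos_pos)
    qed
    ultimately show "\<exists>D. (?D has_real_derivative D) (at y) \<and> D \<le> 0" by blast
  qed
  also have "?D 0 = std_normal_density 0" using pos[of 0] by (simp add: normal_excess_def)
  finally show ?thesis using pos[of x] by (simp add: field_simps)
qed

lemma normal_excess_mult_bound: "normal_excess x * normal_excess (- x) \<le> std_normal_density 0 * std_normal_density x"
  using normal_excess_mult_bound_pos[of x] normal_excess_mult_bound_pos[of "- x"]
  by (cases "x \<ge> 0") (auto simp: std_normal_density_minus mult.commute)

section \<open>The Stein equation\<close>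

lemma abs_diff_le_of_deriv_bound:
  fixes f f1 :: "real \<Rightarrow> real"
  assumes "\<And>x. (f has_real_derivative f1 x) (at x)" "\<And>x. \<bar>f1 x\<bar> \<le> B"
  shows "\<bar>f x - f y\<bar> \<le> B * \<bar>x - y\<bar>"
  using field_differentiable_bound[of UNIV f f1 B x y] assms by (auto simp: has_field_derivative_at_within)

lemma abs_le_of_deriv_bound:
  fixes f f1 :: "real \<Rightarrow> real"
  assumes "\<And>x. (f has_real_derivative f1 x) (at x)" "\<And>x. \<bar>f1 x\<bar> \<le> 1"
  shows "\<bar>f x\<bar> \<le> \<bar>f 0\<bar> + \<bar>x\<bar>"
proof -
  have "\<bar>f x - f 0\<bar> \<le> 1 * \<bar>x - 0\<bar>" by (rule abs_diff_le_of_deriv_bound[OF assms])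
  hence d: "\<bar>f x - f 0\<bar> \<le> \<bar>x\<bar>" by simp
  have "\<bar>f x\<bar> = \<bar>f 0 + (f x - f 0)\<bar>" by simp
  also have "\<dots> \<le> \<bar>f 0\<bar> + \<bar>f x - f 0\<bar>" by (rule abs_triangle_ineq)
  also have "\<dots> \<le> \<bar>f 0\<bar> + \<bar>x\<bar>" by (rule add_left_mono[OF d])
  finally show ?thesis .
qed

text \<open>The test function enters \<open>f\<close> only through \<open>P\<close> and
  \<open>Q\<close>, which its Lipschitz property bounds by \<open>normal_excess x\<close> and
  \<open>normal_excess (- x)\<close>; the identity function attains the bound on \<open>P\<close>.
  Each estimate then becomes a statement about Gaussian functions: an identity for \<open>f\<close>,
  \<open>normal_excess_mult_bound\<close> for \<open>f1\<close>, and \<open>Mills_lower\<close> with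
  an identity for \<open>f2\<close>.\<close>

lemma stein_solution:
  fixes g h :: "real \<Rightarrow> real"
  assumes g: "continuous_on UNIV g" and g1: "\<And>x. \<bar>g x\<bar> \<le> 1"
    and h: "\<And>x. (h has_real_derivative g x) (at x)"
  obtains f f1 f2 where
    "\<And>x. (f has_real_derivative f1 x) (at x)" "\<And>x. (f1 has_real_derivative f2 x) (at x)"
    "\<And>x. \<bar>f x\<bar> \<le> 1" "\<And>x. \<bar>f1 x\<bar> \<le> sqrt 2 / sqrt pi" "\<And>x. \<bar>f2 x\<bar> \<le> 2"
    "\<And>x. f1 x - x * f x = h x - (\<integral>t. std_normal_density t * h t \<partial>lborel)"
proof -
  let ?p = std_normal_density
  define m where "m = (\<integral>t. ?p t * h t \<partial>lborel)"
  define H where "H x = (LINT t:{..x}|lborel. ?p t * h t)" for x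
  \<comment> \<open>\<open>P x\<close> and \<open>Q x\<close> are the expectations of \<open>h x - h Z\<close> on \<open>Z \<le> x\<close> and of \<open>h Z - h x\<close> on \<open>Z > x\<close>;
    the solution \<open>f\<close> below is the usual integral formula rewritten in terms of them.\<close>
  define P Q where "P x = h x * Phi x - H x" and "Q x = m - H x - h x * (1 - Phi x)" for x
  have p: "?p x > 0" for x by (simp add: normal_density_pos)
  have h_cont: "continuous_on UNIV h" using h by (meson DERIV_continuous_on has_field_derivative_at_within)
  have h_meas [measurable]: "h \<in> borel_measurable borel"
    by (rule borel_measurable_continuous_onI[OF h_cont])
  have h_lip: "\<bar>h x - h y\<bar> \<le> \<bar>x - y\<bar>" for x y
    using abs_diff_le_of_deriv_bound[OF h g1, of x y] by simp
  have i1: "integrable lborel (\<lambda>t. ?p t * t)" using integrable_std_normal_moment[of 1] by simp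
  have ih: "integrable lborel (\<lambda>t. ?p t * h t)"
  proof (rule Bochner_Integration.integrable_bound)
    show "integrable lborel (\<lambda>t. ?p t * \<bar>h 0\<bar> + ?p t * \<bar>t\<bar>)"
      using integrable_std_normal_moment_abs[of 1] by (intro Bochner_Integration.integrable_add) auto
    have "?p t * \<bar>h t\<bar> \<le> ?p t * (\<bar>h 0\<bar> + \<bar>t\<bar>)" for t
      using h_lip[of t 0] by (intro mult_left_mono) auto
    thus "AE t in lborel. norm (?p t * h t) \<le> norm (?p t * \<bar>h 0\<bar> + ?p t * \<bar>t\<bar>)"
      by (auto simp: abs_mult distrib_left abs_of_nonneg)
  qed simp
  have I: "integrable lborel (\<lambda>t. indicator {..x} t * (?p t * k t))" if "integrable lborel (\<lambda>t. ?p t * k t)" for x k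
    using integrable_mult_indicator[of "{..x}" lborel, OF _ that] by simp
  have I0: "integrable lborel (\<lambda>t. indicator {..x} t * ?p t)" for x
    using I[of "\<lambda>_. 1"] by simp
  have Phi_int: "(\<integral>t. indicator {..x} t * ?p t \<partial>lborel) = Phi x" for x
    unfolding Phi_eq set_lebesgue_integral_def by simp
  have H_int: "(\<integral>t. indicator {..x} t * (?p t * h t) \<partial>lborel) = H x" for x
    unfolding H_def set_lebesgue_integral_def by simp
  have mom_int: "(\<integral>t. indicator {..x} t * (?p t * t) \<partial>lborel) = - ?p x" for x
    using std_normal_first_moment_atMost[of x] unfolding set_lebesgue_integral_def by simp
  have mom0: "(\<integral>t. ?p t * t \<partial>lborel) = 0" using integral_std_normal_moment_odd[of 0] by simp
  have Pb: "\<bar>P x\<bar> \<le> normal_excess x" for x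
  proof -
    have "P x = (\<integral>t. h x * (indicator {..x} t * ?p t) - indicator {..x} t * (?p t * h t) \<partial>lborel)"
      unfolding P_def Phi_int[symmetric] H_int[symmetric]
      by (subst Bochner_Integration.integral_diff) (auto intro: I0 I ih)
    moreover have "\<bar>\<dots>\<bar> \<le> (\<integral>t. x * (indicator {..x} t * ?p t) - indicator {..x} t * (?p t * t) \<partial>lborel)"
    proof (rule integral_abs_bound_integral)
      fix t
      have "?p t * \<bar>h x - h t\<bar> \<le> ?p t * (x - t)" if "t \<le> x"
        using h_lip[of x t] that by (intro mult_left_mono) auto
      thus "\<bar>h x * (indicator {..x} t * ?p t) - indicator {..x} t * (?p t * h t)\<bar>
          \<le> x * (indicator {..x} t * ?p t) - indicator {..x} t * (?p t * t)"
        by (auto split: split_indicator simp: abs_mult right_diff_distrib[symmetric] mult.commute left_diff_distrib[symmetric])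
    qed (intro Bochner_Integration.integrable_diff integrable_mult_right I0 I ih i1)+
    moreover have "\<dots> = normal_excess x"
      by (subst Bochner_Integration.integral_diff) (auto intro: I0 I i1 simp: Phi_int mom_int normal_excess_def)
    ultimately show ?thesis by simp
  qed
  have Qb: "\<bar>Q x\<bar> \<le> normal_excess (- x)" for x
  proof -
    have "Q x = (\<integral>t. (?p t * h t - indicator {..x} t * (?p t * h t)) - h x * (?p t - indicator {..x} t * ?p t) \<partial>lborel)"
      by (simp add: I0 I ih Phi_int H_int Q_def m_def)
    moreover have "\<bar>\<dots>\<bar> \<le> (\<integral>t. (?p t * t - indicator {..x} t * (?p t * t)) - x * (?p t - indicator {..x} t * ?p t) \<partial>lborel)"
    proof (rule integral_abs_bound_integral)
      fix t
      have "?p t * \<bar>h t - h x\<bar> \<le> ?p t * (t - x)" if "\<not> t \<le> x"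
        using h_lip[of t x] that by (intro mult_left_mono) auto
      thus "\<bar>(?p t * h t - indicator {..x} t * (?p t * h t)) - h x * (?p t - indicator {..x} t * ?p t)\<bar>
          \<le> (?p t * t - indicator {..x} t * (?p t * t)) - x * (?p t - indicator {..x} t * ?p t)"
        by (auto split: split_indicator simp: abs_mult right_diff_distrib[symmetric] mult.commute left_diff_distrib[symmetric])
    qed (intro Bochner_Integration.integrable_diff integrable_mult_right I0 I ih i1 integrable_normal_density; simp)+
    moreover have "\<dots> = normal_excess (- x)"
      by (simp add: I0 I i1 Phi_int mom_int mom0 normal_excess_minus)
    ultimately show ?thesis by simp
  qed
  have Hd: "(H has_real_derivative ?p x * h x) (at x)" for x
    unfolding H_def[abs_def]
    by (intro has_real_derivative_integral_atMost ih continuous_on_mult continuous_std_normal_density h_cont)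
  have Pd: "(P has_real_derivative g x * Phi x) (at x)" for x
    unfolding P_def[abs_def] by (auto intro!: derivative_eq_intros h Hd)
  have Qd: "(Q has_real_derivative - g x * (1 - Phi x)) (at x)" for x
    unfolding Q_def[abs_def] by (auto intro!: derivative_eq_intros h Hd simp: algebra_simps)
  define f where "f x = - ((1 - Phi x) * P x + Phi x * Q x) / ?p x" for x
  \<comment> \<open>Since \<open>P x - Q x = h x - m\<close>, this is the Stein equation taken as a
    definition; that \<open>f1\<close> is the derivative of \<open>f\<close> is proved afterwards,
    and \<open>f2\<close> is its formal derivative.\<close>
  define f1 where "f1 x = x * f x + (P x - Q x)" for x
  define f2 where "f2 x = f x + x * f1 x + g x" for x
  have fd: "(f has_real_derivative f1 x) (at x)" for x
  proof -
    have "(f has_real_derivative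
       (- ((- ?p x * P x + (1 - Phi x) * (g x * Phi x)) + (?p x * Q x + Phi x * (- g x * (1 - Phi x)))) * ?p x
        - (- ((1 - Phi x) * P x + Phi x * Q x)) * (- x * ?p x)) / (?p x * ?p x)) (at x)"
      unfolding f_def[abs_def] using p[of x] by (auto intro!: derivative_eq_intros Pd Qd)
    also have "(- ((- ?p x * P x + (1 - Phi x) * (g x * Phi x)) + (?p x * Q x + Phi x * (- g x * (1 - Phi x)))) * ?p x
        - (- ((1 - Phi x) * P x + Phi x * Q x)) * (- x * ?p x)) / (?p x * ?p x) = f1 x"
      using p[of x] by (simp add: f1_def f_def divide_simps) algebra
    finally show ?thesis .
  qed
  have f1d: "(f1 has_real_derivative f2 x) (at x)" for x
    unfolding f1_def[abs_def]
    by (auto intro!: derivative_eq_intros Pd Qd fd simp: f2_def f1_def algebra_simps)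
  have A0: "normal_excess x \<ge> 0" for x using Pb[of x] by linarith
  have bound: "\<bar>u * P x + v * Q x\<bar> \<le> \<bar>u\<bar> * normal_excess x + \<bar>v\<bar> * normal_excess (- x)" for u v x
  proof -
    have "\<bar>u * P x\<bar> \<le> \<bar>u\<bar> * normal_excess x" "\<bar>v * Q x\<bar> \<le> \<bar>v\<bar> * normal_excess (- x)"
      using Pb[of x] Qb[of x] by (auto simp: abs_mult intro: mult_left_mono)
    thus ?thesis by linarith
  qed
  have Phi01: "0 \<le> Phi x" "0 \<le> 1 - Phi x" for x
    using std_normal.cdf_nonneg std_normal.cdf_bounded_prob by auto
  have fb: "\<bar>f x\<bar> \<le> 1" for x
  proof -
    have "\<bar>(1 - Phi x) * P x + Phi x * Q x\<bar> \<le> (1 - Phi x) * normal_excess x + Phi x * normal_excess (- x)"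
      using bound[of "1 - Phi x" x "Phi x"] Phi01[of x] by simp
    also have "\<dots> = ?p x" unfolding normal_excess_minus unfolding normal_excess_def by (simp add: algebra_simps)
    finally show ?thesis using p[of x] by (simp add: f_def)
  qed
  have f1b: "\<bar>f1 x\<bar> \<le> sqrt 2 / sqrt pi" for x
  proof -
    \<comment> \<open>The coefficient of \<open>P\<close> is the bound on \<open>Q\<close> and, up
      to sign, conversely, so both summands are estimated by the same product.\<close>
    have "f1 x * ?p x = normal_excess (- x) * P x + (- normal_excess x) * Q x"
      using p[of x] unfolding f1_def f_def normal_excess_minus unfolding normal_excess_def by (simp add: field_simps)
    hence "\<bar>f1 x\<bar> * ?p x \<le> normal_excess (- x) * normal_excess x + normal_excess x * normal_excess (- x)"
      using bound[of "normal_excess (- x)" x "- normal_excess x"] A0[of x] A0[of "- x"] p[of x] by (simp add: abs_mult)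
    also have "\<dots> \<le> 2 * ?p 0 * ?p x" using normal_excess_mult_bound[of x] by (simp add: mult.commute)
    finally have "\<bar>f1 x\<bar> \<le> 2 * ?p 0" using p[of x] by simp
    also have "2 * ?p 0 = sqrt 2 / sqrt pi"
      by (simp add: std_normal_density_def real_sqrt_mult field_simps)
    finally show ?thesis .
  qed
  have f2b: "\<bar>f2 x\<bar> \<le> 2" for x
  proof -
    \<comment> \<open>Up to sign and the factor \<open>?p x\<close>, these are the coefficients of
      \<open>P\<close> and \<open>Q\<close> in \<open>f2 x - g x\<close>. Weighted by the bounds on
      \<open>P\<close> and \<open>Q\<close> they sum to exactly \<open>?p x\<close>, so the bound 2
      is 1 from this part plus 1 from \<open>g\<close>.\<close>
    define u v where "u = (1 + x\<^sup>2) * (1 - Phi x) - x * ?p x" and "v = (1 + x\<^sup>2) * Phi x + x * ?p x"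
    have uv: "u \<ge> 0" "v \<ge> 0"
      using Mills_lower[of x] Mills_lower[of "- x"] by (auto simp: u_def v_def Phi_minus std_normal_density_minus)
    have "(f2 x - g x) * ?p x = - (u * P x + v * Q x)"
      using p[of x] unfolding f2_def f1_def f_def u_def v_def by (simp add: field_simps) algebra
    hence "\<bar>f2 x - g x\<bar> * ?p x = \<bar>u * P x + v * Q x\<bar>"
      using p[of x] by (metis abs_minus_cancel abs_mult abs_of_pos)
    also have "\<dots> \<le> u * normal_excess x + v * normal_excess (- x)"
      using bound[of u x v] uv by simp
    also have "\<dots> = 1 * ?p x"
      unfolding u_def v_def normal_excess_minus unfolding normal_excess_def by (simp add: algebra_simps power2_eq_square)
    finally have "\<bar>f2 x - g x\<bar> \<le> 1" using p[of x] by (simp only: mult_le_cancel_right_pos)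
    thus ?thesis using g1[of x] by linarith
  qed
  have "f1 x - x * f x = h x - m" for x by (simp add: f1_def P_def Q_def algebra_simps)
  thus ?thesis using that[OF fd f1d fb f1b f2b] unfolding m_def by blast
qed

section \<open>Distance to the normal law through Stein operators\<close>

text \<open>The optimal test function, the sign of \<open>D\<close>, need not be continuous. It is
  reached by two limits, both dominated by the absolute value of \<open>D\<close>: continuous
  averages of \<open>D\<close> replace \<open>D\<close> for fixed \<open>d > 0\<close>, then
  \<open>d\<close> tends to 0. Boundedness of \<open>D\<close> makes the primitive \<open>K\<close>
  Lipschitz, hence the averages continuous.\<close>

lemma integral_abs_le_of_continuous_tests:
  fixes D :: "real \<Rightarrow> real"
  assumes D: "integrable lborel D" and bnd: "\<And>t. \<bar>D t\<bar> \<le> B"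
    and rc: "\<And>t. continuous (at_right t) D"
    and test: "\<And>g. continuous_on UNIV g \<Longrightarrow> (\<And>t. \<bar>g t\<bar> \<le> 1) \<Longrightarrow> (\<integral>t. g t * D t \<partial>lborel) \<le> C"
  shows "(\<integral>t. \<bar>D t\<bar> \<partial>lborel) \<le> C"
proof -
  define K where "K x = (LINT t:{..x}|lborel. D t)" for x
  have Kdiff: "K y - K x = integral {x..y} D" if "x \<le> y" for x y
    unfolding K_def by (rule set_integral_atMost_diff[OF D that])
  have Klip: "\<bar>K y - K x\<bar> \<le> B * (y - x)" if "x \<le> y" for x y
  proof -
    have "norm (integral {x..y} D) \<le> B * measure lborel {x..y}"
    proof (rule has_integral_bound_real[where S="{}" and f=D])
      show "0 \<le> B" using bnd[of 0] by simp
      show "(D has_integral integral {x..y} D) {x..y}"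
        by (rule integrable_integral integrable_on_interval_of_lborel[OF D])+
    qed (use bnd in auto)
    thus ?thesis using that by (simp add: Kdiff)
  qed
  have Kc: "continuous_on UNIV K"
  proof (rule lipschitz_on_continuous_on[where L=B], rule lipschitz_onI)
    show "dist (K x) (K y) \<le> B * dist x y" for x y
      using Klip[of x y] Klip[of y x] by (cases "x \<le> y") (auto simp: dist_real_def abs_minus_commute)
    show "0 \<le> B" using bnd[of 0] by simp
  qed
  \<comment> \<open>Test against \<open>E / (\<bar>E\<bar> + d)\<close>, where \<open>E\<close> averages \<open>D\<close> over a short interval to the right;
    by right continuity these averages converge to \<open>D\<close> everywhere.\<close>
  define E where "E n t = (K (t + 1 / real (Suc n)) - K t) * real (Suc n)" for n t
  have Ec: "continuous_on UNIV (E n)" for n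
    unfolding E_def by (intro continuous_intros continuous_on_compose2[OF Kc]) auto
  have Elim: "(\<lambda>n. E n t) \<longlonglongrightarrow> D t" for t
  proof -
    have "((\<lambda>u. integral {t..u} D) has_vector_derivative D t) (at t within ({t..t+1} - {}))"
    proof (rule integral_has_vector_derivative_continuous_at)
      show "continuous (at t within {t..t + 1} - {}) D"
        using rc[of t] at_within_Icc_at_right[of t "t+1"] by simp
    qed (auto intro: integrable_on_interval_of_lborel[OF D])
    hence "((\<lambda>u. (integral {t..u} D - integral {t..t} D) / (u - t)) \<longlongrightarrow> D t) (at t within {t..t+1})"
      by (simp add: has_real_derivative_iff_has_vector_derivative[symmetric] has_field_derivative_iff)
    moreover have "filterlim (\<lambda>n. t + 1 / real (Suc n)) (at t within {t..t+1}) sequentially"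
      unfolding filterlim_at using LIMSEQ_inverse_real_of_nat_add[of t]
      by (auto simp: inverse_eq_divide)
    ultimately have "(\<lambda>n. (integral {t..t + 1 / real (Suc n)} D - integral {t..t} D) / (t + 1 / real (Suc n) - t)) \<longlonglongrightarrow> D t"
      by (rule filterlim_compose)
    moreover have "(integral {t..t + 1 / real (Suc n)} D - integral {t..t} D) / (t + 1 / real (Suc n) - t) = E n t" for n
      by (simp add: E_def Kdiff)
    ultimately show ?thesis by simp
  qed
  have [measurable]: "D \<in> borel_measurable borel" using D by auto
  have [measurable]: "E n \<in> borel_measurable borel" for n
    by (rule borel_measurable_continuous_onI[OF Ec])
  have absD: "integrable lborel (\<lambda>t. \<bar>D t\<bar>)" using D by simp
  have mul: "\<bar>a / (\<bar>a\<bar> + d)\<bar> \<le> 1" if "d > 0" for a d :: real using that by (simp add: divide_le_eq)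
  have mul': "norm (a / (\<bar>a\<bar> + d) * b) \<le> \<bar>b\<bar>" if "d > 0" for a b d :: real
    using mult_right_mono[OF mul[OF that, of a], of "\<bar>b\<bar>"] by (simp only: real_norm_def abs_mult) simp
  have step: "(\<integral>t. D t / (\<bar>D t\<bar> + d) * D t \<partial>lborel) \<le> C" if d: "d > 0" for d
  proof (rule LIMSEQ_le_const2)
    show "(\<lambda>n. \<integral>t. E n t / (\<bar>E n t\<bar> + d) * D t \<partial>lborel) \<longlonglongrightarrow> (\<integral>t. D t / (\<bar>D t\<bar> + d) * D t \<partial>lborel)"
    proof (rule integral_dominated_convergence[where w="\<lambda>t. \<bar>D t\<bar>"])
      show "AE t in lborel. (\<lambda>n. E n t / (\<bar>E n t\<bar> + d) * D t) \<longlonglongrightarrow> D t / (\<bar>D t\<bar> + d) * D t"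
        by (intro always_eventually allI tendsto_intros Elim) (use d in \<open>smt (verit)\<close>)
      show "AE t in lborel. norm (E n t / (\<bar>E n t\<bar> + d) * D t) \<le> \<bar>D t\<bar>" for n
        by (intro always_eventually allI mul' d)
    qed (use absD in auto)
    have "(\<integral>t. E n t / (\<bar>E n t\<bar> + d) * D t \<partial>lborel) \<le> C" for n
    proof (rule test)
      show "continuous_on UNIV (\<lambda>t. E n t / (\<bar>E n t\<bar> + d))"
        by (intro continuous_intros Ec) (use d in \<open>smt (verit)\<close>)
    qed (rule mul[OF d])
    thus "\<exists>N. \<forall>n\<ge>N. (\<integral>t. E n t / (\<bar>E n t\<bar> + d) * D t \<partial>lborel) \<le> C" by blast
  qed
  show ?thesis
  proof (rule LIMSEQ_le_const2)
    show "(\<lambda>n. \<integral>t. D t / (\<bar>D t\<bar> + 1 / real (Suc n)) * D t \<partial>lborel) \<longlonglongrightarrow> (\<integral>t. \<bar>D t\<bar> \<partial>lborel)"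
    proof (rule integral_dominated_convergence[where w="\<lambda>t. \<bar>D t\<bar>"])
      show "AE t in lborel. (\<lambda>n. D t / (\<bar>D t\<bar> + 1 / real (Suc n)) * D t) \<longlonglongrightarrow> \<bar>D t\<bar>"
      proof (intro always_eventually allI)
        fix t
        show "(\<lambda>n. D t / (\<bar>D t\<bar> + 1 / real (Suc n)) * D t) \<longlonglongrightarrow> \<bar>D t\<bar>"
        proof (cases "D t = 0")
          case False
          have "(\<lambda>n. D t / (\<bar>D t\<bar> + 1 / real (Suc n)) * D t) \<longlonglongrightarrow> D t / (\<bar>D t\<bar> + 0) * D t"
            by (intro tendsto_intros LIMSEQ_Suc[OF lim_1_over_n]) (use False in auto)
          also have "D t / (\<bar>D t\<bar> + 0) * D t = \<bar>D t\<bar>" using False by (auto simp: abs_if)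
          finally show ?thesis .
        qed simp
      qed
      show "AE t in lborel. norm (D t / (\<bar>D t\<bar> + 1 / real (Suc n)) * D t) \<le> \<bar>D t\<bar>" for n
        by (intro always_eventually allI mul') simp
    qed (use absD in auto)
    show "\<exists>N. \<forall>n\<ge>N. (\<integral>t. D t / (\<bar>D t\<bar> + 1 / real (Suc n)) * D t \<partial>lborel) \<le> C"
      by (intro exI allI impI step) simp
  qed
qed

text \<open>The antiderivative vanishing at 0, written as one integral over the line so that Fubini applies.\<close>

definition antideriv :: "(real \<Rightarrow> real) \<Rightarrow> real \<Rightarrow> real" where
  "antideriv g x = (\<integral>t. g t * (indicator {0..} t - indicator {x..} t) \<partial>lborel)"

lemma abs_indicator_diff_integral:
  fixes x :: real
  shows "has_bochner_integral lborel (\<lambda>t. \<bar>indicator {0..} t - indicator {x..} t\<bar>) \<bar>x\<bar>"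
proof -
  have "(\<lambda>t. \<bar>indicator {0..} t - indicator {x..} t\<bar>) = (indicator {min 0 x..<max 0 x} :: real \<Rightarrow> real)"
    by (auto simp: fun_eq_iff split: split_indicator)
  moreover have "has_bochner_integral lborel (indicator {min 0 x..<max 0 x} :: real \<Rightarrow> real) (measure lborel {min 0 x..<max 0 x})"
    by (rule has_bochner_integral_real_indicator) auto
  ultimately show ?thesis by (auto simp: min_def max_def split: if_splits)
qed

lemma integrable_antideriv:
  fixes g :: "real \<Rightarrow> real"
  assumes [measurable]: "g \<in> borel_measurable borel" and g1: "\<And>t. \<bar>g t\<bar> \<le> 1"
  shows "integrable lborel (\<lambda>t. g t * (indicator {0..} t - indicator {x..} t))"
proof (rule Bochner_Integration.integrable_bound)
  show "integrable lborel (\<lambda>t. \<bar>indicator {0..} t - indicator {x..} t\<bar> :: real)"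
    using abs_indicator_diff_integral by (rule integrable.intros)
  show "AE t in lborel. norm (g t * (indicator {0..} t - indicator {x..} t)) \<le> norm \<bar>indicator {0..} t - indicator {x..} t :: real\<bar>"
    using g1 by (intro always_eventually allI) (auto split: split_indicator)
qed simp

lemma antideriv_has_derivative:
  fixes g :: "real \<Rightarrow> real"
  assumes g: "continuous_on UNIV g" and g1: "\<And>t. \<bar>g t\<bar> \<le> 1"
  shows "(antideriv g has_real_derivative g x) (at x)"
proof -
  have [measurable]: "g \<in> borel_measurable borel" by (rule borel_measurable_continuous_onI[OF g])
  note i = integrable_antideriv[OF this g1]
  have eq: "antideriv g (x-1) + integral {x-1..y} g = antideriv g y" if "x - 1 \<le> y" for y
  proof -
    have "antideriv g y - antideriv g (x-1) = (\<integral>t. g t * (indicator {0..} t - indicator {y..} t)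
          - g t * (indicator {0..} t - indicator {x-1..} t) \<partial>lborel)"
      unfolding antideriv_def by (rule Bochner_Integration.integral_diff[symmetric]) (rule i)+
    also have "\<dots> = (LINT t:{x-1..y}|lborel. g t)"
      unfolding set_lebesgue_integral_def
      by (rule integral_cong_AE)
         (use that in \<open>auto intro!: eventually_mono[OF AE_lborel_singleton[of y]] split: split_indicator\<close>)
    also have "\<dots> = integral {x-1..y} g"
      by (rule set_borel_integral_eq_integral(2), rule borel_integrable_atLeastAtMost')
         (rule continuous_on_subset[OF g], simp)
    finally show ?thesis by simp
  qed
  have "((\<lambda>u. integral {x-1..u} g) has_real_derivative g x) (at x within {x-1..x+1})"
    by (rule integral_has_real_derivative) (use g in \<open>auto intro: continuous_on_subset\<close>)
  hence "((\<lambda>u. integral {x-1..u} g) has_real_derivative g x) (at x)"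
    by (simp add: at_within_Icc_at)
  hence "((\<lambda>u. antideriv g (x - 1) + integral {x-1..u} g) has_real_derivative g x) (at x)"
    by (auto intro!: derivative_eq_intros)
  thus ?thesis
    by (rule has_field_derivative_transform_within_open[where S="{x-1<..}"]) (auto simp: eq)
qed

text \<open>Fubini for the kernel \<open>indicator {0..} t - indicator {..t} x\<close>: integrating
  over \<open>t\<close> gives the antiderivative, integrating over \<open>x\<close> gives the
  distribution function. The absolute kernel has \<open>t\<close>-integral \<bar>x\<bar>, so a
  finite first moment suffices. The term \<open>indicator {0..}\<close> provides integrability at
  both ends and cancels when two laws are compared.\<close>

lemma (in real_distribution) integral_antideriv:
  fixes g :: "real \<Rightarrow> real"
  assumes [measurable]: "g \<in> borel_measurable borel" and g1: "\<And>t. \<bar>g t\<bar> \<le> 1"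
    and int: "integrable M (\<lambda>x. x)"
  shows "integrable lborel (\<lambda>t. g t * (indicator {0..} t - cdf M t))"
    and "(\<integral>x. antideriv g x \<partial>M) = (\<integral>t. g t * (indicator {0..} t - cdf M t) \<partial>lborel)"
proof -
  interpret P: pair_sigma_finite M lborel ..
  let ?f = "\<lambda>(x, t). g t * (indicator {0..} t - indicator {..t} x)"
  have m: "?f \<in> borel_measurable (M \<Otimes>\<^sub>M lborel)"
    unfolding indicator_def[abs_def] by simp
  have e: "?f (x, t) = g t * (indicator {0..} t - indicator {x..} t)" for x t
    by (simp split: split_indicator)
  have pi: "integrable (M \<Otimes>\<^sub>M lborel) ?f"
  proof (rule P.Fubini_integrable[OF m])
    show "AE x in M. integrable lborel (\<lambda>y. ?f (x, y))"
      unfolding e by (intro always_eventually allI integrable_antideriv assms)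
    show "integrable M (\<lambda>x. LINT y|lborel. norm (?f (x, y)))"
    proof (rule Bochner_Integration.integrable_bound[OF int])
      have "(LINT y|lborel. norm (?f (x, y))) \<le> \<bar>x\<bar>" for x
      proof -
        have "(LINT y|lborel. norm (?f (x, y))) \<le> (LINT y|lborel. \<bar>indicator {0..} y - indicator {x..} y\<bar>)"
          unfolding e
          by (intro integral_mono integrable_norm integrable_antideriv assms
                integrable.intros[OF abs_indicator_diff_integral])
             (use g1 in \<open>auto split: split_indicator\<close>)
        thus ?thesis using has_bochner_integral_integral_eq[OF abs_indicator_diff_integral[of x]] by simp
      qed
      thus "AE x in M. norm (LINT y|lborel. norm (?f (x, y))) \<le> norm x" by simp
      show "(\<lambda>x. LINT y|lborel. norm (?f (x, y))) \<in> borel_measurable M" using m by measurable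
    qed
  qed
  have inner: "(\<integral>x. ?f (x, t) \<partial>M) = g t * (indicator {0..} t - cdf M t)" for t
  proof -
    have "(\<integral>x. indicator {0..} t - indicator {..t} x \<partial>M) = indicator {0..} t - cdf M t"
      by (subst Bochner_Integration.integral_diff)
         (auto simp: cdf_def prob_space[unfolded space_eq_univ] emeasure_eq_measure)
    thus ?thesis by simp
  qed
  show "integrable lborel (\<lambda>t. g t * (indicator {0..} t - cdf M t))"
    using P.integrable_snd[of "\<lambda>x t. ?f (x, t)"] pi unfolding inner[symmetric] by (simp add: case_prod_beta')
  have "(\<integral>x. antideriv g x \<partial>M) = (\<integral>x. (\<integral>t. ?f (x, t) \<partial>lborel) \<partial>M)"
    by (simp only: antideriv_def e)
  also have "\<dots> = (\<integral>t. (\<integral>x. ?f (x, t) \<partial>M) \<partial>lborel)"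
    using P.Fubini_integral[of "\<lambda>x t. ?f (x, t)"] pi by (simp add: case_prod_beta')
  finally show "(\<integral>x. antideriv g x \<partial>M) = (\<integral>t. g t * (indicator {0..} t - cdf M t) \<partial>lborel)"
    by (simp only: inner)
qed


lemma continuous_at_right_diff_Phi:
  assumes "finite_borel_measure \<mu>"
  shows "continuous (at_right t) (\<lambda>t. cdf \<mu> t - Phi t)"
  by (intro continuous_diff finite_borel_measure.cdf_is_right_cont[OF assms] std_normal.cdf_is_right_cont)

text \<open>For \<open>h\<close> an antiderivative of \<open>- g\<close>, the Stein equation turns
  the difference of the expectations of \<open>h\<close> under the two laws into one integral under
  \<open>\<mu>\<close>. A one-sided bound is enough because \<open>- g\<close> is a test function as
  well.\<close>

lemma d1_std_normal_le:
  assumes \<mu>: "real_distribution \<mu>" and int: "integrable \<mu> (\<lambda>x. x)"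
    and stein: "\<And>f f1 f2. (\<And>x. (f has_real_derivative f1 x) (at x)) \<Longrightarrow>
      (\<And>x. (f1 has_real_derivative f2 x) (at x)) \<Longrightarrow>
      (\<And>x. \<bar>f x\<bar> \<le> 1) \<Longrightarrow> (\<And>x. \<bar>f1 x\<bar> \<le> sqrt 2 / sqrt pi) \<Longrightarrow> (\<And>x. \<bar>f2 x\<bar> \<le> 2) \<Longrightarrow>
      (\<integral>x. f1 x - x * f x \<partial>\<mu>) \<le> C"
  shows "d1 \<mu> std_normal_distribution \<le> ennreal C"
proof -
  interpret \<mu>: real_distribution \<mu> by (rule \<mu>)
  have intZ: "integrable std_normal_distribution (\<lambda>x. x)"
    using integrable_std_normal_moment[of 1] by (subst integrable_density) auto
  let ?D = "\<lambda>t. cdf \<mu> t - Phi t"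
  note I\<mu> = \<mu>.integral_antideriv[OF _ _ int] and IZ = std_normal.integral_antideriv[OF _ _ intZ]
  \<comment> \<open>The case \<open>g = 1\<close> of the Fubini formula: both distribution functions
    differ from \<open>indicator {0..}\<close> by integrable functions.\<close>
  have D: "integrable lborel ?D"
    using Bochner_Integration.integrable_diff[OF IZ(1)[of "\<lambda>_. 1"] I\<mu>(1)[of "\<lambda>_. 1"]] by simp
  have "(\<integral>t. \<bar>?D t\<bar> \<partial>lborel) \<le> C"
  proof (rule integral_abs_le_of_continuous_tests[OF D])
    fix t show "\<bar>?D t\<bar> \<le> 1"
      using \<mu>.cdf_nonneg[of t] \<mu>.cdf_bounded_prob[of t] std_normal.cdf_nonneg[of t] std_normal.cdf_bounded_prob[of t]
      by linarith
    show "continuous (at_right t) ?D"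
      by (intro continuous_at_right_diff_Phi \<mu>.finite_borel_measure_axioms)
  next
    fix g :: "real \<Rightarrow> real"
    assume g: "continuous_on UNIV g" and g1: "\<And>t. \<bar>g t\<bar> \<le> 1"
    define g' where "g' t = - g t" for t
    define h where "h = antideriv g'"
    have g': "continuous_on UNIV g'" "\<bar>g' t\<bar> \<le> 1" for t
      unfolding g'_def using g g1 by (auto intro: continuous_intros)
    have m: "g' \<in> borel_measurable borel" by (rule borel_measurable_continuous_onI[OF g'(1)])
    have hd: "(h has_real_derivative g' x) (at x)" for x
      unfolding h_def by (rule antideriv_has_derivative[OF g'])
    obtain f f1 f2 where f: "\<And>x. (f has_real_derivative f1 x) (at x)" "\<And>x. (f1 has_real_derivative f2 x) (at x)"
       "\<And>x. \<bar>f x\<bar> \<le> 1" "\<And>x. \<bar>f1 x\<bar> \<le> sqrt 2 / sqrt pi" "\<And>x. \<bar>f2 x\<bar> \<le> 2"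
       "\<And>x. f1 x - x * f x = h x - (\<integral>t. std_normal_density t * h t \<partial>lborel)"
      by (rule stein_solution[OF g' hd], rule that, assumption+)
    have hc: "continuous_on UNIV h" using hd by (meson DERIV_continuous_on has_field_derivative_at_within)
    have hm [measurable]: "h \<in> borel_measurable borel" by (rule borel_measurable_continuous_onI[OF hc])
    have Z: "(\<integral>t. std_normal_density t * h t \<partial>lborel) = (\<integral>t. h t \<partial>std_normal_distribution)"
      by (subst integral_density) auto
    have h_lip: "\<bar>h x\<bar> \<le> \<bar>h 0\<bar> + \<bar>x\<bar>" for x
      by (rule abs_le_of_deriv_bound[OF hd g'(2)])
    have hi: "integrable \<mu> h"
    proof (rule Bochner_Integration.integrable_bound)
      show "integrable \<mu> (\<lambda>x. \<bar>h 0\<bar> + \<bar>x\<bar>)"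
        by (intro Bochner_Integration.integrable_add integrable_abs int) simp
      show "h \<in> borel_measurable \<mu>" using hm by simp
      have "norm (h x) \<le> norm (\<bar>h 0\<bar> + \<bar>x\<bar>)" for x
        unfolding real_norm_def by (rule order_trans[OF h_lip abs_ge_self])
      thus "AE x in \<mu>. norm (h x) \<le> norm (\<bar>h 0\<bar> + \<bar>x\<bar>)" by (rule always_eventually[OF allI])
    qed
    have "(\<integral>t. g t * ?D t \<partial>lborel) = (\<integral>t. g' t * (indicator {0..} t - cdf \<mu> t) - g' t * (indicator {0..} t - Phi t) \<partial>lborel)"
      by (rule Bochner_Integration.integral_cong) (auto simp: g'_def algebra_simps)
    also have "\<dots> = (\<integral>x. h x \<partial>\<mu>) - (\<integral>x. h x \<partial>std_normal_distribution)"
      unfolding h_def I\<mu>(2)[OF m g'(2)] IZ(2)[OF m g'(2)]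
      by (rule Bochner_Integration.integral_diff[OF I\<mu>(1)[OF m g'(2)] IZ(1)[OF m g'(2)]])
    also have "\<dots> = (\<integral>x. f1 x - x * f x \<partial>\<mu>)"
      unfolding f(6) Z using hi \<mu>.prob_space by (simp del: \<mu>.space_eq_univ)
    also have "\<dots> \<le> C" by (rule stein[OF f(1-5)])
    finally show "(\<integral>t. g t * ?D t \<partial>lborel) \<le> C" .
  qed
  moreover have "d1 \<mu> std_normal_distribution = ennreal (\<integral>t. \<bar>?D t\<bar> \<partial>lborel)"
    unfolding d1_def by (rule nn_integral_eq_integral) (use D in auto)
  ultimately show ?thesis by (simp add: ennreal_leI)
qed

section \<open>Random sums\<close>

lemma abs_integral_le_integral:
  fixes f g :: "'a \<Rightarrow> real"
  assumes "integrable M f" "integrable M g" "\<And>x. \<bar>f x\<bar> \<le> g x"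
  shows "\<bar>\<integral>x. f x \<partial>M\<bar> \<le> (\<integral>x. g x \<partial>M)"
  by (rule order_trans[OF integral_abs_bound integral_mono[OF integrable_abs[OF assms(1)] assms(2,3)]])

text \<open>The Lagrange remainder is \<open>f2 t / 2 * y\<^sup>2\<close>, so the bound 2 on
  \<open>f2\<close> gives constant 1. The case \<open>y = 0\<close> is separate because Taylor's
  theorem needs two distinct points.\<close>

lemma second_order_taylor_bound:
  fixes f f1 f2 :: "real \<Rightarrow> real"
  assumes f: "\<And>x. (f has_real_derivative f1 x) (at x)" "\<And>x. (f1 has_real_derivative f2 x) (at x)"
    and b: "\<And>x. \<bar>f2 x\<bar> \<le> 2"
  shows "\<bar>f (v + y) - f v - y * f1 v\<bar> \<le> y\<^sup>2"
proof (cases "y = 0")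
  case False
  let ?d = "\<lambda>m::nat. if m = 0 then f else if m = 1 then f1 else f2"
  have D: "\<forall>m t. m < 2 \<and> v - \<bar>y\<bar> \<le> t \<and> t \<le> v + \<bar>y\<bar> \<longrightarrow> DERIV (?d m) t :> ?d (Suc m) t"
    using f by (auto simp: less_2_cases_iff)
  have "\<exists>t. (if v + y < v then v + y < t \<and> t < v else v < t \<and> t < v + y) \<and>
      f (v + y) = (\<Sum>m<2. ?d m v / fact m * (v + y - v) ^ m) + ?d 2 t / fact 2 * (v + y - v) ^ 2"
    by (rule Taylor[OF _ _ D]) (use False in auto)
  then obtain t where "f (v + y) = (\<Sum>m<2. ?d m v / fact m * (v + y - v) ^ m) + ?d 2 t / fact 2 * (v + y - v) ^ 2"
    by blast
  hence "f (v + y) - f v - y * f1 v = f2 t / 2 * y\<^sup>2"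
    by (simp add: numeral_2_eq_2)
  moreover have "\<bar>f2 t / 2 * y\<^sup>2\<bar> \<le> 1 * y\<^sup>2"
    unfolding abs_mult using b[of t] by (intro mult_mono) auto
  ultimately show ?thesis by simp
qed simp

text \<open>The counter is stored as a real number at index 0, so that one independence statement
  about a family of real variables covers the counter together with the summands.\<close>

locale random_sum = prob_space M for M :: "'a measure" +
  fixes Y :: "nat \<Rightarrow> 'a \<Rightarrow> real" and N :: "'a \<Rightarrow> nat" and n :: nat
  assumes indep: "indep_vars (\<lambda>_. borel) (\<lambda>i \<omega>. if i = 0 then real (N \<omega>) else Y i \<omega>) {0..n}"
    and N_meas [measurable]: "N \<in> measurable M (count_space UNIV)"
    and mean: "\<And>i. i \<in> {1..n} \<Longrightarrow> expectation (Y i) = 0"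
    and sq: "\<And>i. i \<in> {1..n} \<Longrightarrow> integrable M (\<lambda>\<omega>. (Y i \<omega>)\<^sup>2)"
begin

definition J :: "nat \<Rightarrow> 'a \<Rightarrow> real" where "J i \<omega> = (if i \<le> N \<omega> then 1 else 0)"
definition W :: "'a \<Rightarrow> real" where "W \<omega> = (\<Sum>i=1..n. J i \<omega> * Y i \<omega>)"
definition V :: "nat \<Rightarrow> 'a \<Rightarrow> real" where "V i \<omega> = (\<Sum>j\<in>{1..n}-{i}. J j \<omega> * Y j \<omega>)"
definition tail :: "nat \<Rightarrow> real" where "tail i = \<P>(\<omega> in M. i \<le> N \<omega>)"
abbreviation var :: "nat \<Rightarrow> real" where "var i \<equiv> expectation (\<lambda>\<omega>. (Y i \<omega>)\<^sup>2)"

section \<open>Factorization and second moments of the random sum\<close>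

lemma Y_meas: "i \<in> {1..n} \<Longrightarrow> Y i \<in> borel_measurable M"
  using indep by (auto simp: indep_vars_def dest!: bspec[of _ _ i])

lemma J_meas [measurable]: "J i \<in> borel_measurable M"
  unfolding J_def[abs_def] by measurable

lemma V_meas [measurable]: "V i \<in> borel_measurable M"
  unfolding V_def[abs_def] using Y_meas by (intro borel_measurable_sum borel_measurable_times) auto

lemma W_meas [measurable]: "W \<in> borel_measurable M"
  unfolding W_def[abs_def] using Y_meas by (intro borel_measurable_sum borel_measurable_times) auto

lemma J_nonneg: "0 \<le> J i \<omega>" by (simp add: J_def)

lemma W_split: "i \<in> {1..n} \<Longrightarrow> W \<omega> = V i \<omega> + J i \<omega> * Y i \<omega>"
    unfolding W_def V_def by (subst sum.remove[of _ i]) auto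

lemma Y_integrable: "i \<in> {1..n} \<Longrightarrow> integrable M (Y i)"
  by (rule square_integrable_imp_integrable[OF Y_meas sq])

lemma J_mult_integrable: "integrable M X \<Longrightarrow> integrable M (\<lambda>\<omega>. J i \<omega> * X \<omega>)" for X :: "'a \<Rightarrow> real"
  by (rule Bochner_Integration.integrable_bound[of M X]) (auto simp: J_def)

lemma J_integrable: "integrable M (J i)"
  using J_mult_integrable[of "\<lambda>_. 1" i] by simp

lemma expectation_J: "expectation (J i) = tail i"
proof -
  have "expectation (J i) = expectation (indicator {\<omega> \<in> space M. i \<le> N \<omega>})"
    by (rule Bochner_Integration.integral_cong) (auto simp: J_def)
  thus ?thesis by (simp add: tail_def)
qed

lemma tail_bounds: "0 \<le> tail i" "tail i \<le> 1" by (auto simp: tail_def)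

lemma bounded_integrable:
  fixes F :: "'a \<Rightarrow> real"
  assumes "F \<in> borel_measurable M" "\<And>\<omega>. \<bar>F \<omega>\<bar> \<le> B"
  shows "integrable M F"
  by (rule integrable_const_bound[of _ B]) (use assms in auto)

text \<open>The index set splits into \<open>{i}\<close> and the rest, which contains the counter at
  0; \<open>J i\<close> and \<open>V i\<close> are functions of the rest only. Independence also
  supplies integrability of the product.\<close>

lemma factor:
  fixes g k :: "real \<Rightarrow> real"
  assumes i: "i \<in> {1..n}" and [measurable]: "g \<in> borel_measurable borel" "k \<in> borel_measurable borel"
    and int: "integrable M (\<lambda>\<omega>. k (Y i \<omega>))" "integrable M (\<lambda>\<omega>. J i \<omega> * g (V i \<omega>))"
  shows "integrable M (\<lambda>\<omega>. k (Y i \<omega>) * (J i \<omega> * g (V i \<omega>)))"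
    and "expectation (\<lambda>\<omega>. k (Y i \<omega>) * (J i \<omega> * g (V i \<omega>))) =
      expectation (\<lambda>\<omega>. k (Y i \<omega>)) * expectation (\<lambda>\<omega>. J i \<omega> * g (V i \<omega>))"
proof -
  let ?U = "\<lambda>i \<omega>. if i = 0 then real (N \<omega>) else Y i \<omega>"
  let ?B = "{0..n} - {i}"
  \<comment> \<open>\<open>G\<close> recovers the indicators from the real-valued coordinate 0,
    hence the comparisons between reals.\<close>
  define G where "G u = (if real i \<le> u 0 then 1 else 0) * g (\<Sum>j\<in>{1..n}-{i}. (if real j \<le> u 0 then 1 else 0) * u j)" for u :: "nat \<Rightarrow> real"
  have 0: "0 \<in> ?B" using i by simp
  have [measurable]: "(\<lambda>u. u j) \<in> borel_measurable (PiM ?B (\<lambda>_. borel))" if "j \<in> ?B" for j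
    using that by (rule measurable_component_singleton)
  have [measurable]: "(\<lambda>u. u 0) \<in> borel_measurable (PiM ?B (\<lambda>_. borel))"
    by (rule measurable_component_singleton[OF 0])
  have s: "(\<lambda>u. \<Sum>j\<in>{1..n}-{i}. (if real j \<le> u 0 then 1 else 0) * u j) \<in> borel_measurable (PiM ?B (\<lambda>_. borel :: real measure))"
  proof (rule borel_measurable_sum)
    fix j assume "j \<in> {1..n} - {i}"
    hence [measurable]: "(\<lambda>u. u j) \<in> borel_measurable (PiM ?B (\<lambda>_. borel :: real measure))"
      by (intro measurable_component_singleton) auto
    show "(\<lambda>u. (if real j \<le> u 0 then 1 else 0) * u j) \<in> borel_measurable (PiM ?B (\<lambda>_. borel :: real measure))"
      by measurable
  qed
  have G: "G \<in> borel_measurable (PiM ?B (\<lambda>_. borel))"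
    unfolding G_def[abs_def] using s by measurable
  have "indep_var borel ((\<lambda>u. k (u i)) \<circ> (\<lambda>\<omega>. restrict (\<lambda>j. ?U j \<omega>) {i})) borel (G \<circ> (\<lambda>\<omega>. restrict (\<lambda>j. ?U j \<omega>) ?B))"
    by (rule indep_var_compose[OF indep_var_restrict[OF indep]])
       (use i G in \<open>auto intro!: measurable_compose[OF measurable_component_singleton]\<close>)
  also have "(\<lambda>u. k (u i)) \<circ> (\<lambda>\<omega>. restrict (\<lambda>j. ?U j \<omega>) {i}) = (\<lambda>\<omega>. k (Y i \<omega>))"
    using i by (auto simp: fun_eq_iff)
  also have "G \<circ> (\<lambda>\<omega>. restrict (\<lambda>j. ?U j \<omega>) ?B) = (\<lambda>\<omega>. J i \<omega> * g (V i \<omega>))"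
  proof
    fix \<omega>
    have "(\<Sum>j\<in>{1..n}-{i}. (if real j \<le> real (N \<omega>) then 1 else 0) * restrict (\<lambda>j. ?U j \<omega>) ?B j) = V i \<omega>"
      unfolding V_def by (rule sum.cong) (auto simp: J_def)
    thus "(G \<circ> (\<lambda>\<omega>. restrict (\<lambda>j. ?U j \<omega>) ?B)) \<omega> = J i \<omega> * g (V i \<omega>)"
      using 0 by (simp add: G_def J_def)
  qed
  finally have iv: "indep_var borel (\<lambda>\<omega>. k (Y i \<omega>)) borel (\<lambda>\<omega>. J i \<omega> * g (V i \<omega>))" .
  show "integrable M (\<lambda>\<omega>. k (Y i \<omega>) * (J i \<omega> * g (V i \<omega>)))"
    by (rule indep_var_integrable[OF iv int])
  show "expectation (\<lambda>\<omega>. k (Y i \<omega>) * (J i \<omega> * g (V i \<omega>))) =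
      expectation (\<lambda>\<omega>. k (Y i \<omega>)) * expectation (\<lambda>\<omega>. J i \<omega> * g (V i \<omega>))"
    by (rule indep_var_lebesgue_integral[OF iv int])
qed

lemma V_integrable: "integrable M (V i)"
  unfolding V_def[abs_def]
  by (intro Bochner_Integration.integrable_sum J_mult_integrable Y_integrable) auto

lemma W_integrable: "integrable M W"
  unfolding W_def[abs_def]
  by (intro Bochner_Integration.integrable_sum J_mult_integrable Y_integrable) auto

lemma factor_J:
  fixes k :: "real \<Rightarrow> real"
  assumes "i \<in> {1..n}" and "k \<in> borel_measurable borel" "integrable M (\<lambda>\<omega>. k (Y i \<omega>))"
  shows "expectation (\<lambda>\<omega>. J i \<omega> * k (Y i \<omega>)) = tail i * expectation (\<lambda>\<omega>. k (Y i \<omega>))"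
  using factor(2)[OF assms(1) _ assms(2,3), of "\<lambda>_. 1"] J_integrable[of i]
  by (simp add: expectation_J mult.commute)

lemma expectation_W: "expectation W = 0"
proof -
  have "expectation W = (\<Sum>i=1..n. expectation (\<lambda>\<omega>. J i \<omega> * Y i \<omega>))"
    unfolding W_def[abs_def]
    by (rule Bochner_Integration.integral_sum) (intro J_mult_integrable Y_integrable)
  also have "\<dots> = 0"
    by (rule sum.neutral) (use factor_J[of _ "\<lambda>y. y"] Y_integrable mean in auto)
  finally show ?thesis .
qed

text \<open>One factor \<open>W\<close> is expanded, and in each term the other is split as
  \<open>V i + J i * Y i\<close>. The part with \<open>V i\<close> has mean zero by
  \<open>factor\<close> and centring; the diagonal part simplifies because \<open>J i\<close> is its
  own square. The dependence among the \<open>J i\<close> thus never enters.\<close>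

lemma second_moment_W: "integrable M (\<lambda>\<omega>. (W \<omega>)\<^sup>2)" "expectation (\<lambda>\<omega>. (W \<omega>)\<^sup>2) = (\<Sum>i=1..n. var i * tail i)"
proof -
  have eq: "(W \<omega>)\<^sup>2 = (\<Sum>i=1..n. Y i \<omega> * (J i \<omega> * V i \<omega>) + J i \<omega> * (Y i \<omega>)\<^sup>2)" for \<omega>
  proof -
    have "(W \<omega>)\<^sup>2 = (\<Sum>i=1..n. J i \<omega> * Y i \<omega> * W \<omega>)"
      unfolding power2_eq_square by (subst W_def) (simp add: sum_distrib_right)
    also have "\<dots> = (\<Sum>i=1..n. Y i \<omega> * (J i \<omega> * V i \<omega>) + J i \<omega> * (Y i \<omega>)\<^sup>2)"
      by (rule sum.cong) (auto simp: W_split J_def algebra_simps power2_eq_square)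
    finally show ?thesis .
  qed
  have t: "integrable M (\<lambda>\<omega>. Y i \<omega> * (J i \<omega> * V i \<omega>))" "expectation (\<lambda>\<omega>. Y i \<omega> * (J i \<omega> * V i \<omega>)) = 0"
    if "i \<in> {1..n}" for i
    using factor[OF that, of "\<lambda>v. v" "\<lambda>y. y"] Y_integrable[OF that] J_mult_integrable[OF V_integrable] mean[OF that]
    by auto
  show "integrable M (\<lambda>\<omega>. (W \<omega>)\<^sup>2)" unfolding eq
    by (intro Bochner_Integration.integrable_sum Bochner_Integration.integrable_add t J_mult_integrable sq)
  have "expectation (\<lambda>\<omega>. (W \<omega>)\<^sup>2)
      = (\<Sum>i=1..n. expectation (\<lambda>\<omega>. Y i \<omega> * (J i \<omega> * V i \<omega>) + J i \<omega> * (Y i \<omega>)\<^sup>2))"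
    unfolding eq by (intro Bochner_Integration.integral_sum Bochner_Integration.integrable_add t J_mult_integrable sq)
  also have "\<dots> = (\<Sum>i=1..n. var i * tail i)"
  proof (rule sum.cong)
    fix i assume i: "i \<in> {1..n}"
    have "expectation (\<lambda>\<omega>. Y i \<omega> * (J i \<omega> * V i \<omega>) + J i \<omega> * (Y i \<omega>)\<^sup>2)
       = 0 + expectation (\<lambda>\<omega>. J i \<omega> * (Y i \<omega>)\<^sup>2)"
      by (subst Bochner_Integration.integral_add) (use t[OF i] J_mult_integrable[OF sq[OF i]] in auto)
    thus "expectation (\<lambda>\<omega>. Y i \<omega> * (J i \<omega> * V i \<omega>) + J i \<omega> * (Y i \<omega>)\<^sup>2) = var i * tail i"
      using factor_J[OF i, of "\<lambda>y. y\<^sup>2"] sq[OF i] by (simp add: mult.commute)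
  qed simp
  finally show "expectation (\<lambda>\<omega>. (W \<omega>)\<^sup>2) = (\<Sum>i=1..n. var i * tail i)" .
qed

lemma variance_W: "variance W = (\<Sum>i=1..n. var i * tail i)"
  using second_moment_W(2) by (simp add: expectation_W)

text \<open>\<open>b1\<close> (Taylor) yields the third moment with constant 1, and
  \<open>b2\<close> (the bound 2 on \<open>f2\<close>) yields \<open>2 * var i\<close> times the
  first absolute moment. The crude bounds \<open>b3\<close> and \<open>b4\<close> end up
  contributing \<open>K * var i * tail i * (1 - tail i)\<close> each, hence the factor 2 on
  \<open>K\<close>.\<close>

lemma stein_term_bound:
  fixes f f1 f2 :: "real \<Rightarrow> real" and K :: real
  assumes f: "\<And>x. (f has_real_derivative f1 x) (at x)" "\<And>x. (f1 has_real_derivative f2 x) (at x)"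
    and b: "\<And>x. \<bar>f x\<bar> \<le> 1" "\<And>x. \<bar>f1 x\<bar> \<le> K" "\<And>x. \<bar>f2 x\<bar> \<le> 2"
    and i: "i \<in> {1..n}" and cube: "integrable M (\<lambda>\<omega>. \<bar>Y i \<omega>\<bar> ^ 3)"
  shows "\<bar>expectation (\<lambda>\<omega>. J i \<omega> * Y i \<omega> * f (W \<omega>)) - var i * tail i * expectation (\<lambda>\<omega>. f1 (W \<omega>))\<bar>
    \<le> (expectation (\<lambda>\<omega>. \<bar>Y i \<omega>\<bar> ^ 3) + 2 * var i * expectation (\<lambda>\<omega>. \<bar>Y i \<omega>\<bar>)) * (tail i)\<^sup>2
      + 2 * K * (var i * tail i - var i * (tail i)\<^sup>2)"
proof -
  note Yi = Y_meas[OF i] 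
  note [measurable] = Yi
  have fc: "continuous_on UNIV f" "continuous_on UNIV f1"
    using f by (meson DERIV_continuous_on has_field_derivative_at_within)+
  have fm [measurable]: "f \<in> borel_measurable borel" "f1 \<in> borel_measurable borel"
    by (auto intro: borel_measurable_continuous_onI fc)
  let ?E = "expectation"
  define a s r q where "a = ?E (\<lambda>\<omega>. J i \<omega> * Y i \<omega> * f (W \<omega>))" and "s = var i"
    and "r = ?E (\<lambda>\<omega>. \<bar>Y i \<omega>\<bar> ^ 3)" and "q = ?E (\<lambda>\<omega>. \<bar>Y i \<omega>\<bar>)"
  have s0: "s \<ge> 0" by (simp add: s_def)
  have ib: "integrable M (\<lambda>\<omega>. f (X \<omega>))" "integrable M (\<lambda>\<omega>. f1 (X \<omega>))" if "X \<in> borel_measurable M" for X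
    by (rule bounded_integrable[OF measurable_compose[OF that fm(1)] b(1)],
        rule bounded_integrable[OF measurable_compose[OF that fm(2)] b(2)])
  note intb = J_mult_integrable[OF ib(1)[OF V_meas[of i]], of i] J_mult_integrable[OF ib(2)[OF V_meas[of i]], of i]
    J_mult_integrable[OF ib(2)[OF W_meas], of i] ib(2)[OF W_meas]
  have k: "(\<lambda>y::real. y) \<in> borel_measurable borel" "(\<lambda>y::real. y\<^sup>2) \<in> borel_measurable borel" by simp_all
  note Fy = factor[where g=f and k="\<lambda>y. y", OF i fm(1) k(1) Y_integrable[OF i] intb(1)]
  note Fy2 = factor[where g=f1 and k="\<lambda>y. y\<^sup>2", OF i fm(2) k(2) sq[OF i] intb(2)]
  have iYf: "integrable M (\<lambda>\<omega>. Y i \<omega> * (J i \<omega> * f (V i \<omega>)))" "?E (\<lambda>\<omega>. Y i \<omega> * (J i \<omega> * f (V i \<omega>))) = 0"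
    by (rule Fy(1), simp only: Fy(2) mean[OF i] mult_zero_left)
  have iY2f: "integrable M (\<lambda>\<omega>. (Y i \<omega>)\<^sup>2 * (J i \<omega> * f1 (V i \<omega>)))"
     "?E (\<lambda>\<omega>. (Y i \<omega>)\<^sup>2 * (J i \<omega> * f1 (V i \<omega>))) = s * ?E (\<lambda>\<omega>. J i \<omega> * f1 (V i \<omega>))"
    by (rule Fy2(1), simp only: Fy2(2) s_def)
  have iYfW: "integrable M (\<lambda>\<omega>. J i \<omega> * Y i \<omega> * f (W \<omega>))"
    by (rule Bochner_Integration.integrable_bound[OF Y_integrable[OF i]])
       (auto simp: abs_mult J_def intro!: AE_I2 mult_left_le b)
  \<comment> \<open>The subtracted term has mean zero, so \<open>a\<close> becomes the expectation
    of an increment of \<open>f\<close> from \<open>V i\<close> to \<open>W\<close>.\<close>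
  have a_eq: "a = ?E (\<lambda>\<omega>. J i \<omega> * Y i \<omega> * f (W \<omega>) - Y i \<omega> * (J i \<omega> * f (V i \<omega>)))"
    using iYf iYfW by (simp add: a_def)
  have pw: "J i \<omega> * Y i \<omega> * f (W \<omega>) - Y i \<omega> * (J i \<omega> * f (V i \<omega>)) = J i \<omega> * (Y i \<omega> * (f (V i \<omega> + Y i \<omega>) - f (V i \<omega>)))" for \<omega>
    using W_split[OF i, of \<omega>] by (simp add: J_def algebra_simps)
  have b1: "\<bar>a - s * ?E (\<lambda>\<omega>. J i \<omega> * f1 (V i \<omega>))\<bar> \<le> tail i * r"
  proof -
    have eq: "a - s * ?E (\<lambda>\<omega>. J i \<omega> * f1 (V i \<omega>)) = ?E (\<lambda>\<omega>. (J i \<omega> * Y i \<omega> * f (W \<omega>) - Y i \<omega> * (J i \<omega> * f (V i \<omega>))) - (Y i \<omega>)\<^sup>2 * (J i \<omega> * f1 (V i \<omega>)))"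
      unfolding a_eq iY2f(2)[symmetric]
      by (rule Bochner_Integration.integral_diff[OF Bochner_Integration.integrable_diff[OF iYfW iYf(1)] iY2f(1), symmetric])
    have "\<bar>a - s * ?E (\<lambda>\<omega>. J i \<omega> * f1 (V i \<omega>))\<bar> \<le> ?E (\<lambda>\<omega>. J i \<omega> * \<bar>Y i \<omega>\<bar> ^ 3)"
      unfolding eq
    proof (rule abs_integral_le_integral)
      fix \<omega>
      have "(J i \<omega> * Y i \<omega> * f (W \<omega>) - Y i \<omega> * (J i \<omega> * f (V i \<omega>))) - (Y i \<omega>)\<^sup>2 * (J i \<omega> * f1 (V i \<omega>))
         = J i \<omega> * (Y i \<omega> * (f (V i \<omega> + Y i \<omega>) - f (V i \<omega>) - Y i \<omega> * f1 (V i \<omega>)))"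
        unfolding pw by (simp add: algebra_simps power2_eq_square)
      also have "\<bar>\<dots>\<bar> \<le> J i \<omega> * (\<bar>Y i \<omega>\<bar> * (Y i \<omega>)\<^sup>2)"
        unfolding abs_mult abs_of_nonneg[OF J_nonneg]
        by (intro mult_left_mono second_order_taylor_bound[OF f b(3)] J_nonneg abs_ge_zero)
      also have "\<bar>Y i \<omega>\<bar> * (Y i \<omega>)\<^sup>2 = \<bar>Y i \<omega>\<bar> ^ 3"
        by (simp add: power3_eq_cube power2_eq_square)
      finally show "\<bar>(J i \<omega> * Y i \<omega> * f (W \<omega>) - Y i \<omega> * (J i \<omega> * f (V i \<omega>))) - (Y i \<omega>)\<^sup>2 * (J i \<omega> * f1 (V i \<omega>))\<bar> \<le> J i \<omega> * \<bar>Y i \<omega>\<bar> ^ 3" .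
    qed (rule Bochner_Integration.integrable_diff[OF Bochner_Integration.integrable_diff[OF iYfW iYf(1)] iY2f(1)], rule J_mult_integrable[OF cube])
    also have "\<dots> = tail i * r" unfolding r_def
      by (rule factor_J[where k="\<lambda>y. \<bar>y\<bar> ^ 3", OF i _ cube]) measurable
    finally show ?thesis .
  qed
  have b2: "\<bar>?E (\<lambda>\<omega>. J i \<omega> * f1 (V i \<omega>)) - ?E (\<lambda>\<omega>. J i \<omega> * f1 (W \<omega>))\<bar> \<le> 2 * tail i * q"
  proof -
    have eq: "?E (\<lambda>\<omega>. J i \<omega> * f1 (V i \<omega>)) - ?E (\<lambda>\<omega>. J i \<omega> * f1 (W \<omega>)) = ?E (\<lambda>\<omega>. J i \<omega> * f1 (V i \<omega>) - J i \<omega> * f1 (W \<omega>))"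
      by (rule Bochner_Integration.integral_diff[OF intb(2,3), symmetric])
    have "\<bar>?E (\<lambda>\<omega>. J i \<omega> * f1 (V i \<omega>)) - ?E (\<lambda>\<omega>. J i \<omega> * f1 (W \<omega>))\<bar> \<le> ?E (\<lambda>\<omega>. J i \<omega> * (2 * \<bar>Y i \<omega>\<bar>))"
      unfolding eq
    proof (rule abs_integral_le_integral)
      fix \<omega>
      show "\<bar>J i \<omega> * f1 (V i \<omega>) - J i \<omega> * f1 (W \<omega>)\<bar> \<le> J i \<omega> * (2 * \<bar>Y i \<omega>\<bar>)"
        using abs_diff_le_of_deriv_bound[OF f(2) b(3), of "V i \<omega>" "V i \<omega> + Y i \<omega>"] W_split[OF i, of \<omega>] by (auto simp: J_def)
    qed (rule Bochner_Integration.integrable_diff[OF intb(2,3)], rule J_mult_integrable[OF integrable_mult_right[OF integrable_abs[OF Y_integrable[OF i]]]])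
    also have "\<dots> = 2 * tail i * q"
      using factor_J[where k="\<lambda>y. 2 * \<bar>y\<bar>", OF i _ integrable_mult_right[OF integrable_abs[OF Y_integrable[OF i]]]]
      by (simp add: q_def)
    finally show ?thesis .
  qed
  \<comment> \<open>The Lipschitz bound on the increment, instead of a bound on \<open>f\<close>
    itself, gives a variance here, the same order as \<open>s * B\<close>.\<close>
  have b3: "\<bar>a\<bar> \<le> K * (s * tail i)"
  proof -
    have "\<bar>a\<bar> \<le> ?E (\<lambda>\<omega>. J i \<omega> * (K * (Y i \<omega>)\<^sup>2))"
      unfolding a_eq
    proof (rule abs_integral_le_integral)
      fix \<omega>
      have "\<bar>J i \<omega> * (Y i \<omega> * (f (V i \<omega> + Y i \<omega>) - f (V i \<omega>)))\<bar> \<le> J i \<omega> * (\<bar>Y i \<omega>\<bar> * (K * \<bar>V i \<omega> + Y i \<omega> - V i \<omega>\<bar>))"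
        unfolding abs_mult abs_of_nonneg[OF J_nonneg]
        by (intro mult_left_mono abs_diff_le_of_deriv_bound[OF f(1) b(2)] J_nonneg abs_ge_zero)
      thus "\<bar>J i \<omega> * Y i \<omega> * f (W \<omega>) - Y i \<omega> * (J i \<omega> * f (V i \<omega>))\<bar> \<le> J i \<omega> * (K * (Y i \<omega>)\<^sup>2)"
        unfolding pw by (simp add: power2_eq_square mult_ac)
    qed (rule Bochner_Integration.integrable_diff[OF iYfW iYf(1)], rule J_mult_integrable[OF integrable_mult_right[OF sq[OF i]]])
    also have "\<dots> = K * (s * tail i)"
      using factor_J[where k="\<lambda>y. K * y\<^sup>2", OF i _ integrable_mult_right[OF sq[OF i]]] by (simp add: s_def)
    finally show ?thesis .
  qed
  define B C where "B = ?E (\<lambda>\<omega>. J i \<omega> * f1 (W \<omega>))" and "C = ?E (\<lambda>\<omega>. (1 - J i \<omega>) * f1 (W \<omega>))"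
  have iC: "integrable M (\<lambda>\<omega>. (1 - J i \<omega>) * f1 (W \<omega>))"
    using Bochner_Integration.integrable_diff[OF intb(4,3)] by (simp add: algebra_simps)
  have EBC: "?E (\<lambda>\<omega>. f1 (W \<omega>)) = B + C"
    unfolding B_def C_def using Bochner_Integration.integral_add[OF intb(3) iC] by (simp add: algebra_simps)
  have b4: "\<bar>C\<bar> \<le> K * (1 - tail i)"
  proof -
    have "\<bar>C\<bar> \<le> ?E (\<lambda>\<omega>. K * (1 - J i \<omega>))"
      unfolding C_def
    proof (rule abs_integral_le_integral[OF iC])
      show "\<bar>(1 - J i \<omega>) * f1 (W \<omega>)\<bar> \<le> K * (1 - J i \<omega>)" for \<omega>
        using b(2) by (auto simp: J_def)
    qed (intro integrable_mult_right Bochner_Integration.integrable_diff J_integrable; simp)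
    also have "\<dots> = K * (1 - tail i)"
      using J_integrable by (simp add: expectation_J prob_space)
    finally show ?thesis .
  qed
  let ?p = "tail i"
  have aB: "\<bar>a - s * B\<bar> \<le> ?p * (r + 2 * s * q)"
  proof -
    have "\<bar>s * (?E (\<lambda>\<omega>. J i \<omega> * f1 (V i \<omega>)) - B)\<bar> \<le> s * (2 * ?p * q)"
      unfolding abs_mult abs_of_nonneg[OF s0] using b2 s0 by (intro mult_left_mono) (auto simp: B_def)
    with b1 show ?thesis by (simp add: algebra_simps abs_le_iff)
  qed
  \<comment> \<open>Comparing on the event \<open>i \<le> N\<close> only costs a factor \<open>tail i\<close>; what remains has total mass of order
    \<open>tail i * (1 - tail i)\<close> and is bounded trivially. This is where the squared tails come from.\<close>
  have "a - s * ?p * (B + C) = ?p * (a - s * B) + (1 - ?p) * a - s * ?p * C"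
    by (simp add: algebra_simps)
  also have "\<bar>\<dots>\<bar> \<le> ?p * (?p * (r + 2 * s * q)) + (1 - ?p) * (K * (s * ?p)) + s * ?p * (K * (1 - ?p))"
  proof -
    have "\<bar>?p * (a - s * B)\<bar> \<le> ?p * (?p * (r + 2 * s * q))"
      using aB tail_bounds[of i] by (simp add: abs_mult mult_left_mono)
    moreover have "\<bar>(1 - ?p) * a\<bar> \<le> (1 - ?p) * (K * (s * ?p))"
      using b3 tail_bounds[of i] by (simp add: abs_mult mult_left_mono)
    moreover have "\<bar>s * ?p * C\<bar> \<le> s * ?p * (K * (1 - ?p))"
      using b4 tail_bounds[of i] s0 by (simp add: abs_mult mult_left_mono)
    ultimately show ?thesis by linarith
  qed
  also have "\<dots> = (r + 2 * s * q) * ?p\<^sup>2 + 2 * K * (s * ?p - s * ?p\<^sup>2)"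
    by (simp add: algebra_simps power2_eq_square)
  finally show ?thesis unfolding EBC a_def s_def r_def q_def .
qed

text \<open>Because the weights \<open>var i * tail i\<close> sum to 1, the expectation of
  \<open>f1 W\<close> can be distributed over the indices and compared with the expectation of
  \<open>W * f W\<close> term by term.\<close>

lemma d1_W_le:
  assumes cube: "\<And>i. i \<in> {1..n} \<Longrightarrow> integrable M (\<lambda>\<omega>. \<bar>Y i \<omega>\<bar> ^ 3)"
    and unit: "(\<Sum>i=1..n. var i * tail i) = 1"
  shows "d1 (distr M borel W) std_normal_distribution \<le> ennreal
    ((\<Sum>i=1..n. (expectation (\<lambda>\<omega>. \<bar>Y i \<omega>\<bar> ^ 3) + 2 * var i * expectation (\<lambda>\<omega>. \<bar>Y i \<omega>\<bar>)) * (tail i)\<^sup>2)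
      + 2 * (sqrt 2 / sqrt pi) * (1 - (\<Sum>i=1..n. var i * (tail i)\<^sup>2)))"
proof (rule d1_std_normal_le)
  show "real_distribution (distr M borel W)"
    by (rule real_distribution_distr) measurable
  show "integrable (distr M borel W) (\<lambda>x. x)"
    by (subst integrable_distr_eq) (use W_integrable in auto)
next
  fix f f1 f2 :: "real \<Rightarrow> real"
  assume f: "\<And>x. (f has_real_derivative f1 x) (at x)" "\<And>x. (f1 has_real_derivative f2 x) (at x)"
    and b: "\<And>x. \<bar>f x\<bar> \<le> 1" "\<And>x. \<bar>f1 x\<bar> \<le> sqrt 2 / sqrt pi" "\<And>x. \<bar>f2 x\<bar> \<le> 2"
  have fc: "continuous_on UNIV f" "continuous_on UNIV f1"
    using f by (meson DERIV_continuous_on has_field_derivative_at_within)+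
  have fm [measurable]: "f \<in> borel_measurable borel" "f1 \<in> borel_measurable borel"
    by (auto intro: borel_measurable_continuous_onI fc)
  define t where "t i \<omega> = J i \<omega> * Y i \<omega> * f (W \<omega>)" for i \<omega>
  have it: "integrable M (t i)" if "i \<in> {1..n}" for i
    unfolding t_def[abs_def] using Y_meas[OF that]
    by (intro Bochner_Integration.integrable_bound[OF Y_integrable[OF that]])
       (auto simp: abs_mult J_def intro!: AE_I2 mult_left_le b)
  have i1: "integrable M (\<lambda>\<omega>. f1 (W \<omega>))"
    by (rule bounded_integrable[OF measurable_compose[OF W_meas fm(2)] b(2)])
  define e where "e = expectation (\<lambda>\<omega>. f1 (W \<omega>))"
  have Wf: "W \<omega> * f (W \<omega>) = (\<Sum>i=1..n. t i \<omega>)" for \<omega>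
    by (subst (1) W_def) (simp add: t_def sum_distrib_right)
  have "(\<integral>x. f1 x - x * f x \<partial>distr M borel W) = expectation (\<lambda>\<omega>. f1 (W \<omega>) - (\<Sum>i=1..n. t i \<omega>))"
    by (subst integral_distr) (simp_all add: Wf)
  also have "\<dots> = e - (\<Sum>i=1..n. expectation (t i))"
    unfolding e_def using it
    by (subst Bochner_Integration.integral_diff[OF i1]) (auto intro!: Bochner_Integration.integrable_sum)
  finally have lhs: "(\<integral>x. f1 x - x * f x \<partial>distr M borel W) = e - (\<Sum>i=1..n. expectation (t i))" .
  have "e = (\<Sum>i=1..n. var i * tail i * e)"
    unfolding sum_distrib_right[symmetric] unit by simp
  hence diff: "e - (\<Sum>i=1..n. expectation (t i)) = (\<Sum>i=1..n. var i * tail i * e - expectation (t i))"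
    unfolding sum_subtractf by (rule arg_cong[where f="\<lambda>x. x - _"])
  define r where "r i = (expectation (\<lambda>\<omega>. \<bar>Y i \<omega>\<bar> ^ 3) + 2 * var i * expectation (\<lambda>\<omega>. \<bar>Y i \<omega>\<bar>)) * (tail i)\<^sup>2" for i
  have le: "(\<Sum>i=1..n. var i * tail i * e - expectation (t i))
      \<le> (\<Sum>i=1..n. r i + 2 * (sqrt 2 / sqrt pi) * (var i * tail i - var i * (tail i)\<^sup>2))"
  proof (rule sum_mono)
    fix i assume i: "i \<in> {1..n}"
    show "var i * tail i * e - expectation (t i) \<le> r i + 2 * (sqrt 2 / sqrt pi) * (var i * tail i - var i * (tail i)\<^sup>2)"
      using stein_term_bound[OF f b i cube[OF i]] unfolding t_def[abs_def] e_def r_def abs_le_iff by linarith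
  qed
  have "(\<Sum>i=1..n. r i + 2 * (sqrt 2 / sqrt pi) * (var i * tail i - var i * (tail i)\<^sup>2))
      = (\<Sum>i=1..n. r i) + 2 * (sqrt 2 / sqrt pi) * (1 - (\<Sum>i=1..n. var i * (tail i)\<^sup>2))"
    unfolding sum.distrib sum_distrib_left[symmetric] sum_subtractf unit ..
  with le show "(\<integral>x. f1 x - x * f x \<partial>distr M borel W)
    \<le> (\<Sum>i=1..n. (expectation (\<lambda>\<omega>. \<bar>Y i \<omega>\<bar> ^ 3) + 2 * var i * expectation (\<lambda>\<omega>. \<bar>Y i \<omega>\<bar>)) * (tail i)\<^sup>2)
      + 2 * (sqrt 2 / sqrt pi) * (1 - (\<Sum>i=1..n. var i * (tail i)\<^sup>2))"
    unfolding lhs diff r_def by simp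
qed

lemma random_sum_scaled: "random_sum M (\<lambda>i \<omega>. Y i \<omega> / c) N n"
proof unfold_locales
  \<comment> \<open>Index 0 holds the counter and must stay unscaled.\<close>
  have "indep_vars (\<lambda>_. borel) (\<lambda>i \<omega>. (if i = 0 then (\<lambda>x. x) else (\<lambda>x. x / c)) (if i = 0 then real (N \<omega>) else Y i \<omega>)) {0..n}"
    by (rule indep_vars_compose2[OF indep]) auto
  moreover have "(\<lambda>i \<omega>. (if i = 0 then (\<lambda>x. x) else (\<lambda>x. x / c)) (if i = 0 then real (N \<omega>) else Y i \<omega>))
      = (\<lambda>i \<omega>. if i = 0 then real (N \<omega>) else Y i \<omega> / c)"
    by (auto simp: fun_eq_iff)
  ultimately show "indep_vars (\<lambda>_. borel) (\<lambda>i \<omega>. if i = 0 then real (N \<omega>) else Y i \<omega> / c) {0..n}"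
    by (simp only:)
qed (use mean sq in \<open>auto simp: power_divide\<close>)

text \<open>The unit-variance case applied to \<open>Y i / \<sigma>\<close>. Both moment terms are
  homogeneous of degree three, which gives the common factor
  \<open>1 / \<sigma> ^ 3\<close>.\<close>

theorem d1_normalized_le:
  assumes cube: "\<And>i. i \<in> {1..n} \<Longrightarrow> integrable M (\<lambda>\<omega>. \<bar>Y i \<omega>\<bar> ^ 3)"
    and \<sigma>: "\<sigma> > 0" "\<sigma>\<^sup>2 = variance W"
  shows "d1 (distr M borel (\<lambda>\<omega>. W \<omega> / \<sigma>)) std_normal_distribution \<le> ennreal
    (1 / \<sigma> ^ 3 * (\<Sum>i=1..n. (expectation (\<lambda>\<omega>. \<bar>Y i \<omega>\<bar> ^ 3) + 2 * var i * expectation (\<lambda>\<omega>. \<bar>Y i \<omega>\<bar>)) * (tail i)\<^sup>2)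
      + 2 * sqrt 2 / sqrt pi * (1 - (\<Sum>i=1..n. var i / \<sigma>\<^sup>2 * (tail i)\<^sup>2)))"
proof -
  interpret S: random_sum M "\<lambda>i \<omega>. Y i \<omega> / \<sigma>" N n by (rule random_sum_scaled)
  have W: "S.W = (\<lambda>\<omega>. W \<omega> / \<sigma>)"
    by (rule ext) (simp only: S.W_def W_def sum_divide_distrib times_divide_eq_right)
  have var: "S.var i = var i / \<sigma>\<^sup>2" for i
    by (simp only: power_divide integral_divide_zero)
  have m3: "expectation (\<lambda>\<omega>. \<bar>Y i \<omega> / \<sigma>\<bar> ^ 3) = expectation (\<lambda>\<omega>. \<bar>Y i \<omega>\<bar> ^ 3) / \<sigma> ^ 3"
    and m1: "expectation (\<lambda>\<omega>. \<bar>Y i \<omega> / \<sigma>\<bar>) = expectation (\<lambda>\<omega>. \<bar>Y i \<omega>\<bar>) / \<sigma>" for i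
    using \<sigma> by (simp_all add: abs_divide power_divide)
  have unit: "(\<Sum>i=1..n. S.var i * S.tail i) = 1"
  proof -
    have "(\<Sum>i=1..n. S.var i * S.tail i) = (\<Sum>i=1..n. var i * tail i) / \<sigma>\<^sup>2"
      unfolding var by (simp only: times_divide_eq_left sum_divide_distrib)
    also have "\<dots> = 1" unfolding variance_W[symmetric] \<sigma>(2)[symmetric] using \<sigma>(1) by simp
    finally show ?thesis .
  qed
  have cube': "integrable M (\<lambda>\<omega>. \<bar>Y i \<omega> / \<sigma>\<bar> ^ 3)" if "i \<in> {1..n}" for i
    using cube[OF that] \<sigma> by (simp add: abs_divide power_divide)
  have eq: "(expectation (\<lambda>\<omega>. \<bar>Y i \<omega>\<bar> ^ 3) / \<sigma> ^ 3 + 2 * (var i / \<sigma>\<^sup>2) * (expectation (\<lambda>\<omega>. \<bar>Y i \<omega>\<bar>) / \<sigma>)) * (tail i)\<^sup>2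
    = 1 / \<sigma> ^ 3 * ((expectation (\<lambda>\<omega>. \<bar>Y i \<omega>\<bar> ^ 3) + 2 * var i * expectation (\<lambda>\<omega>. \<bar>Y i \<omega>\<bar>)) * (tail i)\<^sup>2)" for i
    using \<sigma>(1) by (simp add: field_simps power3_eq_cube power2_eq_square)
  show ?thesis
    using S.d1_W_le[OF cube' unit] unfolding W var m3 m1 eq sum_distrib_left[symmetric] by simp
qed

end

section \<open>Independence of the summands and the counter\<close>

lemma indep_elements_prob:
  assumes "prob_space M" "indep_elements M S X T Y" "A \<in> sets S" "B \<in> sets T"
  shows "measure M ((X -` A \<inter> space M) \<inter> (Y -` B \<inter> space M))
    = measure M (X -` A \<inter> space M) * measure M (Y -` B \<inter> space M)"
proof -
  interpret prob_space M by fact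
  show ?thesis
    using assms(2-4) unfolding indep_elements_def
    by (intro indep_setD[of "sigma_sets (space M) {X -` A \<inter> space M | A. A \<in> sets S}"
          "sigma_sets (space M) {Y -` A \<inter> space M | A. A \<in> sets T}"]) (auto intro!: sigma_sets.Basic)
qed

text \<open>Independence of the possibly infinite \<open>family\<close> elements is used only on
  these events, where the finitely many coordinates in \<open>K\<close> are constrained.\<close>

definition cylinder :: "'i set \<Rightarrow> 'i set \<Rightarrow> ('i \<Rightarrow> real set) \<Rightarrow> ('i \<Rightarrow> real) set" where
  "cylinder I K A = {x \<in> space (\<Pi>\<^sub>M i\<in>I. borel). \<forall>i\<in>K. x i \<in> A i}"

lemma sets_cylinder:
  fixes A :: "'i \<Rightarrow> real set"
  assumes "K \<subseteq> I" "finite K" "\<And>i. A i \<in> sets borel"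
  shows "cylinder I K A \<in> sets (\<Pi>\<^sub>M i\<in>I. borel)"
  unfolding cylinder_def
proof (rule sets.sets_Collect_finite_All[OF _ assms(2)])
  fix i assume i: "i \<in> K"
  have "(\<lambda>x. x i) -` A i \<inter> space (\<Pi>\<^sub>M i\<in>I. borel) \<in> sets (\<Pi>\<^sub>M i\<in>I. borel :: real measure)"
    using i assms(1,3)
    by (intro measurable_sets[where A=borel] measurable_component_singleton[where M="\<lambda>_. borel"]) auto
  moreover have "{x \<in> space (\<Pi>\<^sub>M i\<in>I. borel :: real measure). x i \<in> A i} = (\<lambda>x. x i) -` A i \<inter> space (\<Pi>\<^sub>M i\<in>I. borel)"
    by auto
  ultimately show "{x \<in> space (\<Pi>\<^sub>M i\<in>I. borel). x i \<in> A i} \<in> sets (\<Pi>\<^sub>M i\<in>I. borel :: real measure)"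
    by simp
qed

lemma family_vimage_cylinder:
  "K \<subseteq> I \<Longrightarrow> family I X -` cylinder I K A \<inter> S = {\<omega>\<in>S. \<forall>i\<in>K. X i \<omega> \<in> A i}"
  by (auto simp: cylinder_def family_def space_PiM)

text \<open>The empty \<open>K\<close> is included because either group may contribute no index
  below \<open>n\<close>.\<close>

lemma (in prob_space) indep_vars_prob_Ball:
  assumes "indep_vars M' X I" "K \<subseteq> I" "finite K" "\<And>i. i \<in> K \<Longrightarrow> A i \<in> sets (M' i)"
  shows "prob {\<omega>\<in>space M. \<forall>i\<in>K. X i \<omega> \<in> A i} = (\<Prod>i\<in>K. prob (X i -` A i \<inter> space M))"
proof (cases "K = {}")
  case False
  have "{\<omega>\<in>space M. \<forall>i\<in>K. X i \<omega> \<in> A i} = (\<Inter>i\<in>K. X i -` A i \<inter> space M)"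
    using False by auto
  thus ?thesis using indep_varsD[OF assms(1) False assms(3,2,4)] by simp
qed (simp add: prob_space)

text \<open>The product formula is peeled off in three stages: the counter from all summands by
  \<open>iN\<close>, the first group from the second by \<open>i12\<close>, and single variables
  within each group by \<open>i1\<close> and \<open>i2\<close>.\<close>

lemma (in prob_space) indep_vars_with_counter:
  fixes X :: "nat \<Rightarrow> 'a \<Rightarrow> real" and N :: "'a \<Rightarrow> nat"
  assumes i1: "indep_vars (\<lambda>_. borel) X {1..n1}" and i2: "indep_vars (\<lambda>_. borel) X {n1+1..}"
    and i12: "indep_elements M (\<Pi>\<^sub>M i\<in>{1..n1}. borel) (family {1..n1} X) (\<Pi>\<^sub>M i\<in>{n1+1..}. borel) (family {n1+1..} X)"
    and iN: "indep_elements M (count_space UNIV) N (\<Pi>\<^sub>M i\<in>{1..}. borel) (family {1..} X)"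
  shows "indep_vars (\<lambda>_. borel) (\<lambda>i \<omega>. if i = 0 then real (N \<omega>) else X i \<omega>) {0..n}"
proof -
  let ?U = "\<lambda>i \<omega>. if i = 0 then real (N \<omega>) else X i \<omega>"
  have N [measurable]: "N \<in> measurable M (count_space UNIV)"
    using iN by (simp add: indep_elements_def)
  have Xm: "X i \<in> borel_measurable M" if "i \<ge> 1" for i
    using i1 i2 that by (cases "i \<le> n1") (auto simp: indep_vars_def)
  have groups: "prob {\<omega>\<in>space M. \<forall>i\<in>{1..n}. X i \<omega> \<in> A i} = (\<Prod>i\<in>{1..n}. prob (X i -` A i \<inter> space M))"
    if A: "\<And>i. A i \<in> sets borel" for A
  proof -
    define K1 K2 where "K1 = {1..n} \<inter> {1..n1}" and "K2 = {1..n} \<inter> {n1+1..}"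
    have K: "{1..n} = K1 \<union> K2" "K1 \<inter> K2 = {}" "finite K1" "finite K2" "K1 \<subseteq> {1..n1}" "K2 \<subseteq> {n1+1..}"
      by (auto simp: K1_def K2_def)
    have "{\<omega>\<in>space M. \<forall>i\<in>{1..n}. X i \<omega> \<in> A i}
        = {\<omega>\<in>space M. \<forall>i\<in>K1. X i \<omega> \<in> A i} \<inter> {\<omega>\<in>space M. \<forall>i\<in>K2. X i \<omega> \<in> A i}"
      unfolding K(1) by auto
    also have "prob \<dots> = prob {\<omega>\<in>space M. \<forall>i\<in>K1. X i \<omega> \<in> A i} * prob {\<omega>\<in>space M. \<forall>i\<in>K2. X i \<omega> \<in> A i}"
      using indep_elements_prob[OF prob_space_axioms i12 sets_cylinder[OF K(5,3) A] sets_cylinder[OF K(6,4) A]]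
      unfolding family_vimage_cylinder[OF K(5)] family_vimage_cylinder[OF K(6)] .
    also have "\<dots> = (\<Prod>i\<in>K1. prob (X i -` A i \<inter> space M)) * (\<Prod>i\<in>K2. prob (X i -` A i \<inter> space M))"
      using indep_vars_prob_Ball[OF i1 K(5,3)] indep_vars_prob_Ball[OF i2 K(6,4)] A by simp
    also have "\<dots> = (\<Prod>i\<in>{1..n}. prob (X i -` A i \<inter> space M))"
      unfolding K(1) by (rule prod.union_disjoint[symmetric]) (use K in auto)
    finally show ?thesis .
  qed
  show ?thesis
  proof (subst indep_vars_finite[where E="\<lambda>_. sets borel"])
    show "random_variable borel (?U i)" if "i \<in> {0..n}" for i
      using Xm[of i] by (cases "i = 0") auto
    show "sets borel = sigma_sets (space borel) (sets borel)" by (metis sets.sigma_sets_eq)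
    show "\<forall>A\<in>{0..n} \<rightarrow> sets borel. prob (\<Inter>j\<in>{0..n}. ?U j -` A j \<inter> space M) = (\<Prod>j\<in>{0..n}. prob (?U j -` A j \<inter> space M))"
    proof
      fix A :: "nat \<Rightarrow> real set" assume "A \<in> {0..n} \<rightarrow> sets borel"
      \<comment> \<open>The given sets are measurable only for indices up to \<open>n\<close>, while
        \<open>sets_cylinder\<close> asks for measurability at every index.\<close>
      define A' where "A' i = (if i \<le> n then A i else {})" for i
      have A: "A' i \<in> sets borel" for i
        using \<open>A \<in> _\<close> by (auto simp: A'_def Pi_def)
      have sub: "{1..n} \<subseteq> {1..}" by auto
      have "(\<Inter>j\<in>{0..n}. ?U j -` A j \<inter> space M)
          = (N -` (real -` A' 0) \<inter> space M) \<inter> {\<omega>\<in>space M. \<forall>i\<in>{1..n}. X i \<omega> \<in> A' i}"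
        by (fastforce simp: A'_def split: if_splits)
      also have "prob \<dots> = prob (N -` (real -` A' 0) \<inter> space M) * prob {\<omega>\<in>space M. \<forall>i\<in>{1..n}. X i \<omega> \<in> A' i}"
        using indep_elements_prob[OF prob_space_axioms iN _ sets_cylinder[OF sub finite_atLeastAtMost A], of "real -` A' 0"]
        unfolding family_vimage_cylinder[OF sub] by simp
      also have "\<dots> = prob (?U 0 -` A 0 \<inter> space M) * (\<Prod>j\<in>{1..n}. prob (?U j -` A j \<inter> space M))"
        unfolding groups[OF A] by (intro arg_cong2[where f="(*)"] prod.cong) (auto simp: A'_def vimage_def)
      also have "\<dots> = (\<Prod>j\<in>{0..n}. prob (?U j -` A j \<inter> space M))"
        by (simp add: prod.atLeast_Suc_atMost)
      finally show "prob (\<Inter>j\<in>{0..n}. ?U j -` A j \<inter> space M) = (\<Prod>j\<in>{0..n}. prob (?U j -` A j \<inter> space M))" .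
    qed
  qed (auto simp: Int_stable_def)
qed

text \<open>If \<open>n1 > n\<close>, the first sum on the right runs past \<open>n\<close> and the
  second is empty; the vanishing of \<open>h\<close> beyond \<open>n\<close> absorbs the excess. It
  is applied to terms containing tails of \<open>N\<close>.\<close>

lemma sum_groups:
  fixes h :: "nat \<Rightarrow> 'b::comm_monoid_add"
  assumes "\<And>i. i > n \<Longrightarrow> h i = 0"
  shows "(\<Sum>i=1..n. h i) = (\<Sum>i=1..n1. h i) + (\<Sum>i=n1+1..n. h i)"
proof (cases "n1 \<le> n")
  case True
  have "{1..n} = {1..n1} \<union> {n1+1..n}" using True by auto
  thus ?thesis by (simp add: sum.union_disjoint)
next
  case False
  have "(\<Sum>i=1..n. h i) = (\<Sum>i=1..n1. h i)"
    by (rule sum.mono_neutral_left) (use False assms in auto)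
  thus ?thesis using False by simp
qed

section \<open>Moments determined by the law, finite and infinite\<close>

lemma distr_eq_imp_moments_eq:
  fixes X Y :: "'a \<Rightarrow> real"
  assumes [measurable]: "X \<in> borel_measurable M" "Y \<in> borel_measurable M"
    and eq: "distr M borel X = distr M borel Y"
  shows "(\<integral>\<omega>. (X \<omega>)\<^sup>2 \<partial>M) = (\<integral>\<omega>. (Y \<omega>)\<^sup>2 \<partial>M)" "moment_term M X = moment_term M Y"
proof -
  have nn: "(\<integral>\<^sup>+\<omega>. ennreal (k (X \<omega>)) \<partial>M) = (\<integral>\<^sup>+\<omega>. ennreal (k (Y \<omega>)) \<partial>M)" if [measurable]: "k \<in> borel_measurable borel" for k :: "real \<Rightarrow> real"
    using nn_integral_distr[of X M borel "\<lambda>x. ennreal (k x)"] nn_integral_distr[of Y M borel "\<lambda>x. ennreal (k x)"] eq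
    by simp
  show "(\<integral>\<omega>. (X \<omega>)\<^sup>2 \<partial>M) = (\<integral>\<omega>. (Y \<omega>)\<^sup>2 \<partial>M)"
    using integral_distr[of X M borel "\<lambda>x. x\<^sup>2"] integral_distr[of Y M borel "\<lambda>x. x\<^sup>2"] eq by simp
  show "moment_term M X = moment_term M Y"
    using nn[of "\<lambda>x. \<bar>x\<bar> ^ 3"] nn[of "\<lambda>x. x\<^sup>2"] nn[of "\<lambda>x. \<bar>x\<bar>"] by (simp add: moment_term_def)
qed

lemma moment_term_eq_ennreal:
  fixes X :: "'a \<Rightarrow> real"
  assumes "integrable M X" "integrable M (\<lambda>\<omega>. (X \<omega>)\<^sup>2)" "integrable M (\<lambda>\<omega>. \<bar>X \<omega>\<bar> ^ 3)"
  shows "moment_term M X = ennreal ((\<integral>\<omega>. \<bar>X \<omega>\<bar> ^ 3 \<partial>M) + 2 * (\<integral>\<omega>. (X \<omega>)\<^sup>2 \<partial>M) * (\<integral>\<omega>. \<bar>X \<omega>\<bar> \<partial>M))"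
proof -
  have "moment_term M X = ennreal (\<integral>\<omega>. \<bar>X \<omega>\<bar> ^ 3 \<partial>M) + 2 * ennreal (\<integral>\<omega>. (X \<omega>)\<^sup>2 \<partial>M) * ennreal (\<integral>\<omega>. \<bar>X \<omega>\<bar> \<partial>M)"
    unfolding moment_term_def
    using nn_integral_eq_integral[OF assms(3)] nn_integral_eq_integral[OF assms(2)] nn_integral_eq_integral[OF integrable_abs[OF assms(1)]]
    by simp
  also have "2 * ennreal (\<integral>\<omega>. (X \<omega>)\<^sup>2 \<partial>M) * ennreal (\<integral>\<omega>. \<bar>X \<omega>\<bar> \<partial>M)
      = ennreal (2 * (\<integral>\<omega>. (X \<omega>)\<^sup>2 \<partial>M) * (\<integral>\<omega>. \<bar>X \<omega>\<bar> \<partial>M))"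
    by (simp add: ennreal_mult)
  finally show ?thesis by (simp add: ennreal_plus[symmetric] del: ennreal_plus)
qed

lemma moment_term_infinite:
  fixes X :: "'a \<Rightarrow> real"
  assumes [measurable]: "X \<in> borel_measurable M" and "\<not> integrable M (\<lambda>\<omega>. \<bar>X \<omega>\<bar> ^ 3)"
  shows "moment_term M X = \<infinity>"
proof -
  have "integrable M (\<lambda>\<omega>. \<bar>X \<omega>\<bar> ^ 3)" if "(\<integral>\<^sup>+\<omega>. ennreal (\<bar>X \<omega>\<bar> ^ 3) \<partial>M) < \<infinity>"
    by (rule integrableI_nonneg) (use that in auto)
  hence "(\<integral>\<^sup>+\<omega>. ennreal (\<bar>X \<omega>\<bar> ^ 3) \<partial>M) = \<infinity>"
    using assms(2) by (metis less_top infinity_ennreal_def)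
  thus ?thesis by (simp add: moment_term_def)
qed

section \<open>The theorem\<close>

text \<open>\<open>ennreal\<close> sends negative reals to 0, so a negative \<open>b\<close> only
  lowers the left-hand side. This spares a proof that \<open>V \<le> 1\<close> in the final
  estimate.\<close>

lemma ennreal_add_le:
  assumes "a \<ge> 0" shows "ennreal (a + b) \<le> ennreal a + ennreal b"
proof (cases "b \<ge> 0")
  case False
  hence "ennreal (a + b) \<le> ennreal a" by (intro ennreal_leI) simp
  thus ?thesis using False by (simp add: ennreal_neg)
qed (use assms in simp)

theorem corollary3p3:
  fixes M :: "'a measure" and X :: "nat \<Rightarrow> 'a \<Rightarrow> real" and N :: "'a \<Rightarrow> nat"
    and W :: "'a \<Rightarrow> real" and n1 n :: nat and p \<sigma> :: real
  assumes "prob_space M"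
    and "\<And>i. i \<ge> 1 \<Longrightarrow> integrable M (X i)"
    and "\<And>i. i \<ge> 1 \<Longrightarrow> prob_space.expectation M (X i) = 0"
    and "\<And>i. i \<ge> 1 \<Longrightarrow> integrable M (\<lambda>\<omega>. (X i \<omega>)\<^sup>2)"
    and "iid_on M {1..n1} X"
    and "iid_on M {n1+1..} X"
    and "indep_elements M
           (\<Pi>\<^sub>M i\<in>{1..n1}. borel) (family {1..n1} X)
           (\<Pi>\<^sub>M i\<in>{n1+1..}. borel) (family {n1+1..} X)"
    and "0 \<le> p" and "p \<le> 1"
    and "distr M (count_space UNIV) N = measure_pmf (binomial_pmf n p)"
    and "indep_elements M (count_space UNIV) N (\<Pi>\<^sub>M i\<in>{1..}. borel) (family {1..} X)"
    and "\<And>\<omega>. W \<omega> = (\<Sum>i=1..N \<omega>. X i \<omega>)"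
    and "\<sigma>\<^sup>2 = prob_space.variance M W" and "\<sigma> > 0"
  shows "prob_space.variance M W =
           (\<Sum>i=1..n1. prob_space.variance M (X 1) * \<P>(\<omega> in M. N \<omega> \<ge> i)) +
           (\<Sum>i=n1+1..n. prob_space.variance M (X (n1+1)) * \<P>(\<omega> in M. N \<omega> \<ge> i))
       \<and> d1 (distr M borel (\<lambda>\<omega>. W \<omega> / \<sigma>)) std_normal_distribution \<le>
           ennreal (1 / \<sigma> ^ 3) *
             (\<Sum>i=1..n1. moment_term M (X 1) * ennreal (\<P>(\<omega> in M. N \<omega> \<ge> i)\<^sup>2)) +
           ennreal (1 / \<sigma> ^ 3) *
             (\<Sum>i=n1+1..n. moment_term M (X (n1+1)) * ennreal (\<P>(\<omega> in M. N \<omega> \<ge> i)\<^sup>2)) +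
           ennreal (2 * sqrt 2 / sqrt pi *
             (1 - (\<Sum>i=1..n1. prob_space.variance M (X 1) / \<sigma>\<^sup>2 * \<P>(\<omega> in M. N \<omega> \<ge> i)\<^sup>2)
                - (\<Sum>i=n1+1..n. prob_space.variance M (X (n1+1)) / \<sigma>\<^sup>2 * \<P>(\<omega> in M. N \<omega> \<ge> i)\<^sup>2)))"
proof -
  note mean = assms(3) and sq = assms(4)
  interpret prob_space M by (rule assms(1))
  have N [measurable]: "N \<in> measurable M (count_space UNIV)"
    using assms(11) by (simp add: indep_elements_def)
  have Xm: "X i \<in> borel_measurable M" if "i \<ge> 1" for i using assms(2)[OF that] by auto
  have "indep_vars (\<lambda>_. borel) (\<lambda>i \<omega>. if i = 0 then real (N \<omega>) else X i \<omega>) {0..n}"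
    by (rule indep_vars_with_counter[of X n1]) (use assms(5,6,7,11) in \<open>auto simp: iid_on_def\<close>)
  then interpret R: random_sum M X N n
    by unfold_locales (use N mean sq in auto)

  have tail_pmf: "R.tail i = measure_pmf.prob (binomial_pmf n p) {i..}" for i
  proof -
    have "measure (distr M (count_space UNIV) N) {i..} = prob (N -` {i..} \<inter> space M)"
      by (rule measure_distr) auto
    also have "N -` {i..} \<inter> space M = {\<omega> \<in> space M. i \<le> N \<omega>}" by auto
    finally show ?thesis unfolding assms(10) R.tail_def by simp
  qed
  have tail_0_iff: "R.tail i = 0 \<longleftrightarrow> set_pmf (binomial_pmf n p) \<inter> {i..} = {}" for i
    unfolding tail_pmf by (rule measure_pmf_zero_iff)
  have tail_0: "R.tail i = 0" if "i > n" for i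
    unfolding tail_0_iff set_pmf_binomial_eq[OF assms(8,9)] using that by auto
  \<comment> \<open>The binomial law gives \<open>N \<le> n\<close> only almost surely, so
    \<open>W\<close> and the truncated sum \<open>R.W\<close> may differ on a null set.\<close>
  have "AE \<omega> in M. \<not> Suc n \<le> N \<omega>"
    using tail_0[OF lessI] unfolding R.tail_def by (subst prob_Collect_eq_0[symmetric]) auto
  hence W_AE: "AE \<omega> in M. W \<omega> = R.W \<omega>"
  proof eventually_elim
    case (elim \<omega>)
    show ?case unfolding assms(12) R.W_def
      by (rule sum.mono_neutral_cong_left) (use elim in \<open>auto simp: R.J_def\<close>)
  qed
  \<comment> \<open>\<open>M\<close> need not be complete, so almost sure equality with
    \<open>R.W\<close> does not make \<open>W\<close> measurable; it is glued from the countably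
    many sums of fixed length.\<close>
  have "(\<lambda>\<omega>. \<Sum>i=1..k. X i \<omega>) \<in> borel_measurable M" for k
    by (rule borel_measurable_sum) (use Xm in auto)
  hence "(\<lambda>\<omega>. \<Sum>i=1..N \<omega>. X i \<omega>) \<in> borel_measurable M"
    by (rule measurable_compose_countable[OF _ N])
  hence Wm [measurable]: "W \<in> borel_measurable M"
    unfolding assms(12)[symmetric] by simp
  have "variance W = variance R.W"
  proof -
    have "expectation W = expectation R.W" by (rule integral_cong_AE) (use W_AE in auto)
    moreover have "expectation (\<lambda>\<omega>. (W \<omega> - c)\<^sup>2) = expectation (\<lambda>\<omega>. (R.W \<omega> - c)\<^sup>2)" for c
      by (rule integral_cong_AE) (use W_AE in auto)
    ultimately show ?thesis by simp
  qed
  hence var_W: "variance W = (\<Sum>i=1..n. R.var i * R.tail i)" and \<sigma>2: "\<sigma>\<^sup>2 = variance R.W"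
    using R.variance_W assms(13) by simp_all

  have varX: "variance (X i) = R.var i" if "i \<ge> 1" for i using mean[OF that] by simp
  have same: "R.var i = R.var j" "moment_term M (X i) = moment_term M (X j)"
    if "i \<ge> 1" "j \<ge> 1" "distr M borel (X i) = distr M borel (X j)" for i j
    by (rule distr_eq_imp_moments_eq[OF Xm[OF that(1)] Xm[OF that(2)] that(3)])+
  have distr1: "distr M borel (X i) = distr M borel (X 1)" if "i \<in> {1..n1}" for i
    using assms(5) that unfolding iid_on_def by (metis atLeastAtMost_iff le_trans order_refl)
  have distr2: "distr M borel (X i) = distr M borel (X (n1+1))" if "i \<in> {n1+1..n}" for i
    using assms(6) that unfolding iid_on_def by (metis atLeastAtMost_iff atLeast_iff order_refl)
  have g1: "R.var i = R.var 1" "moment_term M (X i) = moment_term M (X 1)" if "i \<in> {1..n1}" for i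
    by (rule same[OF _ _ distr1[OF that]]; use that in simp)+
  have g2: "R.var i = R.var (n1+1)" "moment_term M (X i) = moment_term M (X (n1+1))" if "i \<in> {n1+1..n}" for i
    by (rule same[OF _ _ distr2[OF that]]; use that in simp)+
  \<comment> \<open>\<open>F\<close> covers both the variance formula and the sum with squared
    tails; \<open>F v 0 = 0\<close> removes the terms beyond \<open>n\<close>.\<close>
  have split: "(\<Sum>i=1..n. F (R.var i) (R.tail i))
      = (\<Sum>i=1..n1. F (R.var 1) (R.tail i)) + (\<Sum>i=n1+1..n. F (R.var (n1+1)) (R.tail i))"
    if "\<And>v. F v 0 = 0" for F :: "real \<Rightarrow> real \<Rightarrow> real"
  proof -
    have "(\<Sum>i=1..n. F (R.var i) (R.tail i)) = (\<Sum>i=1..n1. F (R.var i) (R.tail i)) + (\<Sum>i=n1+1..n. F (R.var i) (R.tail i))"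
      by (rule sum_groups) (simp only: tail_0 that)
    also have "\<dots> = (\<Sum>i=1..n1. F (R.var 1) (R.tail i)) + (\<Sum>i=n1+1..n. F (R.var (n1+1)) (R.tail i))"
      by (intro arg_cong2[where f="(+)"] sum.cong refl arg_cong2[where f=F] g1 g2)
    finally show ?thesis .
  qed
  have split': "(\<Sum>i=1..n. moment_term M (X i) * ennreal ((R.tail i)\<^sup>2))
      = (\<Sum>i=1..n1. moment_term M (X 1) * ennreal ((R.tail i)\<^sup>2)) + (\<Sum>i=n1+1..n. moment_term M (X (n1+1)) * ennreal ((R.tail i)\<^sup>2))"
  proof -
    have "(\<Sum>i=1..n. moment_term M (X i) * ennreal ((R.tail i)\<^sup>2))
      = (\<Sum>i=1..n1. moment_term M (X i) * ennreal ((R.tail i)\<^sup>2)) + (\<Sum>i=n1+1..n. moment_term M (X i) * ennreal ((R.tail i)\<^sup>2))"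
      by (rule sum_groups) (simp add: tail_0)
    also have "\<dots> = (\<Sum>i=1..n1. moment_term M (X 1) * ennreal ((R.tail i)\<^sup>2)) + (\<Sum>i=n1+1..n. moment_term M (X (n1+1)) * ennreal ((R.tail i)\<^sup>2))"
      by (intro arg_cong2[where f="(+)"] sum.cong refl arg_cong2[where f="(*)"] g1 g2)
    finally show ?thesis .
  qed

  define S where "S = (\<Sum>i=1..n. moment_term M (X i) * ennreal ((R.tail i)\<^sup>2))"
  define V where "V = (\<Sum>i=1..n. R.var i / \<sigma>\<^sup>2 * (R.tail i)\<^sup>2)"
  have distr_W: "distr M borel (\<lambda>\<omega>. W \<omega> / \<sigma>) = distr M borel (\<lambda>\<omega>. R.W \<omega> / \<sigma>)"
    by (rule distr_cong_AE) (use W_AE in auto)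
  have main: "d1 (distr M borel (\<lambda>\<omega>. W \<omega> / \<sigma>)) std_normal_distribution
      \<le> ennreal (1 / \<sigma> ^ 3) * S + ennreal (2 * sqrt 2 / sqrt pi * (1 - V))"
  proof (cases "\<forall>i\<in>{1..n}. integrable M (\<lambda>\<omega>. \<bar>X i \<omega>\<bar> ^ 3)")
    case True
    define m where "m i = expectation (\<lambda>\<omega>. \<bar>X i \<omega>\<bar> ^ 3) + 2 * R.var i * expectation (\<lambda>\<omega>. \<bar>X i \<omega>\<bar>)" for i
    have m0: "m i \<ge> 0" for i by (simp add: m_def)
    have "S = (\<Sum>i=1..n. ennreal (m i * (R.tail i)\<^sup>2))"
      unfolding S_def
    proof (rule sum.cong)
      fix i assume i: "i \<in> {1..n}"
      have "moment_term M (X i) = ennreal (m i)"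
        unfolding m_def by (rule moment_term_eq_ennreal) (use i True assms(2,4) in auto)
      thus "moment_term M (X i) * ennreal ((R.tail i)\<^sup>2) = ennreal (m i * (R.tail i)\<^sup>2)"
        by (simp add: ennreal_mult m0)
    qed simp
    also have "\<dots> = ennreal (\<Sum>i=1..n. m i * (R.tail i)\<^sup>2)"
      by (rule sum_ennreal) (simp add: m0)
    finally have S: "ennreal (1 / \<sigma> ^ 3) * S = ennreal (1 / \<sigma> ^ 3 * (\<Sum>i=1..n. m i * (R.tail i)\<^sup>2))"
      using assms(14) by (simp add: ennreal_mult'[symmetric])
    have "d1 (distr M borel (\<lambda>\<omega>. R.W \<omega> / \<sigma>)) std_normal_distribution
        \<le> ennreal (1 / \<sigma> ^ 3 * (\<Sum>i=1..n. m i * (R.tail i)\<^sup>2) + 2 * sqrt 2 / sqrt pi * (1 - V))"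
      unfolding V_def m_def by (rule R.d1_normalized_le) (use True assms(14) \<sigma>2 in auto)
    also have "\<dots> \<le> ennreal (1 / \<sigma> ^ 3 * (\<Sum>i=1..n. m i * (R.tail i)\<^sup>2)) + ennreal (2 * sqrt 2 / sqrt pi * (1 - V))"
      using assms(14) m0 by (intro ennreal_add_le sum_nonneg mult_nonneg_nonneg) auto
    finally show ?thesis unfolding distr_W S .
  next
    \<comment> \<open>Then the right-hand side is infinite.\<close>
    case False
    then obtain i where i: "i \<in> {1..n}" "\<not> integrable M (\<lambda>\<omega>. \<bar>X i \<omega>\<bar> ^ 3)" by blast
    \<comment> \<open>Zero times infinity is zero in \<open>ennreal\<close>, so the infinite moment
      term counts only if \<open>R.tail i\<close> is positive. If \<open>p = 0\<close>, then
      \<open>\<sigma>\<close> would be 0; otherwise \<open>n\<close> is in the support of the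
      binomial law and every tail up to \<open>n\<close> is positive.\<close>
    have "p \<noteq> 0"
    proof
      assume "p = 0"
      hence "R.tail j = 0" if "j \<ge> 1" for j
        unfolding tail_0_iff using that by auto
      hence "\<sigma>\<^sup>2 = 0" unfolding assms(13) var_W by simp
      thus False using assms(14) by simp
    qed
    hence "R.tail i \<noteq> 0"
      unfolding tail_0_iff set_pmf_binomial_eq[OF assms(8,9)] using i(1) by (auto split: if_splits)
    moreover have "moment_term M (X i) = \<infinity>"
      by (rule moment_term_infinite) (use i Xm in auto)
    ultimately have "moment_term M (X i) * ennreal ((R.tail i)\<^sup>2) = \<infinity>"
      by (simp add: ennreal_top_mult ennreal_eq_0_iff)
    hence "S = \<infinity>" unfolding S_def using i(1) by (subst sum.remove[of _ i]) auto
    thus ?thesis using assms(14) by (simp add: ennreal_mult_top ennreal_eq_0_iff)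
  qed
  have rhs: "ennreal (1 / \<sigma> ^ 3) * S
      = ennreal (1 / \<sigma> ^ 3) * (\<Sum>i=1..n1. moment_term M (X 1) * ennreal ((R.tail i)\<^sup>2))
        + ennreal (1 / \<sigma> ^ 3) * (\<Sum>i=n1+1..n. moment_term M (X (n1+1)) * ennreal ((R.tail i)\<^sup>2))"
    unfolding S_def split' by (rule distrib_left)
  have v: "1 - V = 1 - (\<Sum>i=1..n1. R.var 1 / \<sigma>\<^sup>2 * (R.tail i)\<^sup>2) - (\<Sum>i=n1+1..n. R.var (n1+1) / \<sigma>\<^sup>2 * (R.tail i)\<^sup>2)"
    unfolding V_def using split[of "\<lambda>v t. v / \<sigma>\<^sup>2 * t\<^sup>2"] by simp
  have var: "variance W = (\<Sum>i=1..n1. R.var 1 * R.tail i) + (\<Sum>i=n1+1..n. R.var (n1+1) * R.tail i)"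
    unfolding var_W using split[of "\<lambda>v t. v * t"] by simp
  have vX: "variance (X 1) = R.var 1" "variance (X (n1+1)) = R.var (n1+1)" by (rule varX; simp)+
  show ?thesis
    unfolding vX R.tail_def[symmetric] by (rule conjI[OF var main[unfolded rhs v]])
qed

end
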